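(* Let $X$ be a compact metric space, $T\colon X\to X$ a homeomorphism, and $\mu\in\mathcal{M}_T(X)$ a $T$-invariant Borel probability measure. The following conditions are equivalent: (1) The measure $\mu$ is ergodic. (2) There exists a Borel set $\hat X_\mu\subseteq X$ with $\mu(\hat X_\mu)=1$ such that every $x\in\hat X_\mu$ is a Wiener--Wintner $\mu$-generic point. (3) There exists a Wiener--Wintner $\mu$-generic point $x\in X$.
   Context: $\mathcal{M}_T(X)$ denotes the set of $T$-invariant Borel probability measures on $X$; $C(X)$ denotes the continuous functions $X\to\mathbb{C}$; $\mathbb{S}^1=\{z\in\mathbb{C}:|z|=1\}$. A point $x\in X$ is generic for $\mu$ if $\frac1n\sum_{j=0}^{n-1}f(T^j(x))\to\int f\,d\mu$ for every $f\in C(X)$. For $f\in C(X)$, $\xi\in\mathbb{S}^1$, $n\ge1$ let $A_n[f,\bar\xi](x)=\frac1n\sum_{j=0}^{n-1}\xi^{-j}f(T^j(x))$, and let $A[f,\bar\xi](x)=\lim_{n\to\infty}A_n[f,\bar\xi](x)$ whenever the limit exists. A point $x$ is Fourier--Bohr $\mu$-generic if it is generic for $\mu$ and $A[f,\bar\xi](x)$ exists for every $f\in C(X)$ and every $\xi\in\mathbb{S}^1$. The set of frequencies of $x$ is $\operatorname{Freq}(x)=\{\xi\in\mathbb{S}^1:\ \limsup_{n\to\infty}|A_n[f,\bar\xi](x)|>0\text{ for some }f\in C(X)\}$. Let $U_T f=f\circ T$ be the Koopman operator on $L^2(X,\mu)$, let $\mathcal{K}\subseteq L^2(X,\mu)$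 be the closed linear span of all eigenfunctions of $U_T$, and let $P_{\mathcal{K}}$ be the orthogonal projection of $L^2(X,\mu)$ onto $\mathcal{K}$. A Fourier--Bohr $\mu$-generic point $x$ is Wiener--Wintner $\mu$-generic if $\|P_{\mathcal{K}}(f)\|_2^2=\sum_{\xi\in\operatorname{Freq}(x)}|A[f,\bar\xi](x)|^2$ for every $f\in C(X)$. *)

theory Defs
  imports "HOL-Probability.Probability"
begin

text \<open>
  The compact metric space \<open>X\<close> is the universe of a type of class \<open>metric_space\<close>, so that
  \<open>C(X)\<close> consists of the functions \<open>f\<close> with \<open>continuous_on UNIV f\<close>; its compactness is assumed where needed.
\<close>

definition invariant_measures :: "('a::topological_space \<Rightarrow> 'a) \<Rightarrow> 'a measure set" where
  "invariant_measures T =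
     {M. sets M = sets borel \<and> prob_space M \<and> distr M borel T = M}"

definition ergodic :: "('a::topological_space \<Rightarrow> 'a) \<Rightarrow> 'a measure \<Rightarrow> bool" where
  "ergodic T M \<longleftrightarrow>
     (\<forall>B\<in>sets borel. T -` B = B \<longrightarrow> measure M B = 0 \<or> measure M B = 1)"

definition generic_point ::
    "('a::topological_space \<Rightarrow> 'a) \<Rightarrow> 'a measure \<Rightarrow> 'a \<Rightarrow> bool" where
  "generic_point T M x \<longleftrightarrow>
     (\<forall>f :: 'a \<Rightarrow> complex. continuous_on UNIV f \<longrightarrow>
        (\<lambda>n. (1 / of_nat n) * (\<Sum>j<n. f ((T ^^ j) x))) \<longlonglongrightarrow> (\<integral>y. f y \<partial>M))"


subsection \<open>Fourier--Bohr averages\<close>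

text \<open>
  \<open>FB_avg T f \<xi> n x\<close> is \<open>A\<^sub>n[f, cnj \<xi>](x)\<close>: the argument is \<open>\<xi>\<close> itself, and the
  conjugation is the negative exponent.
\<close>

definition FB_avg ::
    "('a \<Rightarrow> 'a) \<Rightarrow> ('a \<Rightarrow> complex) \<Rightarrow> complex \<Rightarrow> nat \<Rightarrow> 'a \<Rightarrow> complex" where
  "FB_avg T f \<xi> n x = (1 / of_nat n) * (\<Sum>j<n. \<xi> powi (- int j) * f ((T ^^ j) x))"

definition FB_lim ::
    "('a \<Rightarrow> 'a) \<Rightarrow> ('a \<Rightarrow> complex) \<Rightarrow> complex \<Rightarrow> 'a \<Rightarrow> complex" where
  "FB_lim T f \<xi> x = lim (\<lambda>n. FB_avg T f \<xi> n x)"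

definition FB_generic ::
    "('a::topological_space \<Rightarrow> 'a) \<Rightarrow> 'a measure \<Rightarrow> 'a \<Rightarrow> bool" where
  "FB_generic T M x \<longleftrightarrow>
     generic_point T M x \<and>
     (\<forall>f. continuous_on UNIV f \<longrightarrow>
        (\<forall>\<xi>\<in>sphere 0 1. convergent (\<lambda>n. FB_avg T f \<xi> n x)))"

definition Freq :: "('a::topological_space \<Rightarrow> 'a) \<Rightarrow> 'a \<Rightarrow> complex set" where
  "Freq T x =
     {\<xi>\<in>sphere 0 1. \<exists>f. continuous_on UNIV f \<and>
        limsup (\<lambda>n. ereal (cmod (FB_avg T f \<xi> n x))) > 0}"


subsection \<open>The Kronecker subspace of \<open>L\<^sup>2\<close>\<close>

text \<open>
  Elements of \<open>L\<^sup>2\<close> are represented by square-integrable functions; equality in \<open>L\<^sup>2\<close> is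
  equality almost everywhere.
\<close>

definition L2_space :: "'a measure \<Rightarrow> ('a \<Rightarrow> complex) set" where
  "L2_space M = {f\<in>borel_measurable M. integrable M (\<lambda>x. (cmod (f x))\<^sup>2)}"

definition L2_inner :: "'a measure \<Rightarrow> ('a \<Rightarrow> complex) \<Rightarrow> ('a \<Rightarrow> complex) \<Rightarrow> complex" where
  "L2_inner M f g = (\<integral>x. f x * cnj (g x) \<partial>M)"

definition L2_norm :: "'a measure \<Rightarrow> ('a \<Rightarrow> complex) \<Rightarrow> real" where
  "L2_norm M f = sqrt (\<integral>x. (cmod (f x))\<^sup>2 \<partial>M)"

definition koopman :: "('a \<Rightarrow> 'a) \<Rightarrow> ('a \<Rightarrow> complex) \<Rightarrow> 'a \<Rightarrow> complex" where
  "koopman T f = f \<circ> T"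

definition eigenfunctions :: "('a \<Rightarrow> 'a) \<Rightarrow> 'a measure \<Rightarrow> ('a \<Rightarrow> complex) set" where
  "eigenfunctions T M =
     {f\<in>L2_space M. \<not> (AE x in M. f x = 0) \<and>
        (\<exists>c. AE x in M. koopman T f x = c * f x)}"

definition complex_span :: "('a \<Rightarrow> complex) set \<Rightarrow> ('a \<Rightarrow> complex) set" where
  "complex_span E = {\<lambda>x. \<Sum>g\<in>F. c g * g x | F c. finite F \<and> F \<subseteq> E}"

definition L2_closure :: "'a measure \<Rightarrow> ('a \<Rightarrow> complex) set \<Rightarrow> ('a \<Rightarrow> complex) set" where
  "L2_closure M V =
     {f\<in>L2_space M. \<forall>e>0. \<exists>h\<in>V. L2_norm M (\<lambda>x. f x - h x) < e}"

definition kronecker_space :: "('a \<Rightarrow> 'a) \<Rightarrow> 'a measure \<Rightarrow> ('a \<Rightarrow> complex) set" where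
  "kronecker_space T M = L2_closure M (complex_span (eigenfunctions T M))"

text \<open>
  For a closed subspace \<open>K\<close> of \<open>L\<^sup>2\<close> and \<open>f\<close> in \<open>L\<^sup>2\<close>, a function as chosen below exists by
  the projection theorem and is unique up to a null set, so its \<open>L\<^sup>2\<close> norm does not depend on
  the choice.
\<close>

definition orth_proj ::
    "'a measure \<Rightarrow> ('a \<Rightarrow> complex) set \<Rightarrow> ('a \<Rightarrow> complex) \<Rightarrow> 'a \<Rightarrow> complex" where
  "orth_proj M K f = (SOME g. g \<in> K \<and> (\<forall>h\<in>K. L2_inner M (\<lambda>x. f x - g x) h = 0))"


subsection \<open>Wiener--Wintner generic points\<close>

text \<open>
  The identity is stated with \<open>has_sum\<close> so that it includes convergence of the series; an
  \<open>infsum\<close> would be \<open>0\<close> on divergence.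
\<close>

definition WW_generic ::
    "('a::topological_space \<Rightarrow> 'a) \<Rightarrow> 'a measure \<Rightarrow> 'a \<Rightarrow> bool" where
  "WW_generic T M x \<longleftrightarrow>
     FB_generic T M x \<and>
     (\<forall>f. continuous_on UNIV f \<longrightarrow>
        ((\<lambda>\<xi>. (cmod (FB_lim T f \<xi> x))\<^sup>2) has_sum
           (L2_norm M (orth_proj M (kronecker_space T M) f))\<^sup>2) (Freq T x))"

end

theory Submission
  imports Defs
begin

text \<open>
  Write \<open>A\<^sub>n f\<close> for the averages twisted by \<open>\<xi>\<close>. Both implications rest on comparing, for each
  frequency \<open>\<xi>\<close>, the pointwise quantity \<open>|A[f,\<xi>](x)|\<close> with the \<open>L\<^sup>2\<close> quantity
  \<open>p\<^sub>\<xi>(f) = lim \<parallel>A\<^sub>n f\<parallel>\<close>.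

  For every invariant measure the mean ergodic theorem identifies \<open>p\<^sub>\<xi>(f)\<close> with the norm of the
  projection of \<open>f\<close> to the \<open>\<xi>\<close>-eigenspace (\<open>eigen_part_lim\<close>, \<open>L2_inner_eigen_part\<close>). Eigenspaces
  are orthogonal, so \<open>\<parallel>P\<^sub>K f\<parallel>\<^sup>2\<close> is the sum of \<open>p\<^sub>\<xi>(f)\<^sup>2\<close> over the whole circle
  (\<open>kronecker_norm_has_sum\<close>). If \<open>x\<close> is generic, van der Corput's trick gives
  \<open>limsup |A\<^sub>n f(x)| \<le> p\<^sub>\<xi>(f)\<close> for every \<open>\<xi>\<close> (\<open>generic_FB_avg_bound\<close>). The Wiener--Wintner
  identity therefore holds exactly when these inequalities are equalities.

  If \<open>x\<close> is Wiener--Wintner generic, equality at \<open>\<xi> = 1\<close> says that the invariant part of a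
  continuous function has the norm of its mean, hence is that mean almost everywhere. Every
  invariant set is then independent of all closed sets, hence of itself, and the measure is ergodic.

  Conversely let the measure be ergodic. Where \<open>p\<^sub>\<xi>(f) = 0\<close>, the averages converge to \<open>0\<close> at every
  generic point, which disposes of all but countably many \<open>\<xi>\<close> with one null set, since the
  \<open>p\<^sub>\<xi>(f)\<^sup>2\<close> are summable. For the remaining \<open>\<xi>\<close> there is a unimodular eigenfunction \<open>e\<close>, and
  the twisted averages of \<open>f\<close> are \<open>e(x)\<close> times the Birkhoff averages of \<open>f \<cdot> cnj e\<close>
  (\<open>ergodic_FB_avg_converges\<close>), which converge almost everywhere. Averages and \<open>p\<^sub>\<xi>\<close> are
  \<open>1\<close>-Lipschitz for the uniform norm, so a countable dense set of functions \<open>f\<close> suffices.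
\<close>

section \<open>Square-integrable functions\<close>

lemma borel_measurable_cnj [measurable (raw)]:
  assumes "f \<in> borel_measurable M"
  shows "(\<lambda>x. cnj (f x)) \<in> borel_measurable M"
  by (rule borel_measurable_continuous_on[OF _ assms]) (intro continuous_intros)

lemma L2_spaceI:
  "f \<in> borel_measurable M \<Longrightarrow> integrable M (\<lambda>x. (cmod (f x))\<^sup>2) \<Longrightarrow> f \<in> L2_space M"
  by (simp add: L2_space_def)

lemma L2_measurable: "f \<in> L2_space M \<Longrightarrow> f \<in> borel_measurable M"
  by (simp add: L2_space_def)

lemma L2_integrable_sq: "f \<in> L2_space M \<Longrightarrow> integrable M (\<lambda>x. (cmod (f x))\<^sup>2)"
  by (simp add: L2_space_def)

lemma (in finite_measure) L2_bounded:
  fixes f :: "'a \<Rightarrow> complex"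
  assumes [measurable]: "f \<in> borel_measurable M" and "\<And>x. cmod (f x) \<le> C"
  shows "f \<in> L2_space M"
proof (rule L2_spaceI)
  show "integrable M (\<lambda>x. (cmod (f x))\<^sup>2)"
    using assms(2) by (intro integrable_const_bound[where B = "C\<^sup>2"]) (auto intro!: power_mono)
qed fact

lemma L2_integrable_mult_norm:
  assumes f: "f \<in> L2_space M" and g: "g \<in> L2_space M"
  shows "integrable M (\<lambda>x. cmod (f x) * cmod (g x))"
proof (rule Bochner_Integration.integrable_bound)
  note [measurable] = L2_measurable[OF f] L2_measurable[OF g]
  show "integrable M (\<lambda>x. (cmod (f x))\<^sup>2 + (cmod (g x))\<^sup>2)"
    using f g by (auto simp: L2_space_def)
  show "(\<lambda>x. cmod (f x) * cmod (g x)) \<in> borel_measurable M" by measurable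
  show "AE x in M. norm (cmod (f x) * cmod (g x)) \<le> norm ((cmod (f x))\<^sup>2 + (cmod (g x))\<^sup>2)"
  proof (rule AE_I2)
    fix x
    have "2 * (cmod (f x) * cmod (g x)) \<le> (cmod (f x))\<^sup>2 + (cmod (g x))\<^sup>2"
      using sum_squares_bound[of "cmod (f x)" "cmod (g x)"] by (simp add: mult.assoc)
    moreover have "0 \<le> cmod (f x) * cmod (g x)" by simp
    ultimately have "cmod (f x) * cmod (g x) \<le> (cmod (f x))\<^sup>2 + (cmod (g x))\<^sup>2"
      by linarith
    then show "norm (cmod (f x) * cmod (g x)) \<le> norm ((cmod (f x))\<^sup>2 + (cmod (g x))\<^sup>2)"
      by simp
  qed
qed

lemma L2_integrable_mult:
  assumes f: "f \<in> L2_space M" and g: "g \<in> L2_space M"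
  shows "integrable M (\<lambda>x. f x * cnj (g x))"
proof (rule Bochner_Integration.integrable_bound[OF L2_integrable_mult_norm[OF f g]])
  note [measurable] = L2_measurable[OF f] L2_measurable[OF g]
  show "(\<lambda>x. f x * cnj (g x)) \<in> borel_measurable M" by measurable
qed (simp add: norm_mult)

lemma L2_add:
  assumes f: "f \<in> L2_space M" and g: "g \<in> L2_space M"
  shows "(\<lambda>x. f x + g x) \<in> L2_space M"
proof (rule L2_spaceI)
  note [measurable] = L2_measurable[OF f] L2_measurable[OF g]
  show "(\<lambda>x. f x + g x) \<in> borel_measurable M" by measurable
  show "integrable M (\<lambda>x. (cmod (f x + g x))\<^sup>2)"
  proof (rule Bochner_Integration.integrable_bound)
    show "integrable M (\<lambda>x. 2 * (cmod (f x))\<^sup>2 + 2 * (cmod (g x))\<^sup>2)"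
      using f g by (auto simp: L2_space_def)
    show "AE x in M. norm ((cmod (f x + g x))\<^sup>2) \<le> norm (2 * (cmod (f x))\<^sup>2 + 2 * (cmod (g x))\<^sup>2)"
    proof (rule AE_I2)
      fix x
      have "(cmod (f x + g x))\<^sup>2 \<le> (cmod (f x) + cmod (g x))\<^sup>2"
        by (intro power_mono norm_triangle_ineq) auto
      also have "\<dots> \<le> 2 * (cmod (f x))\<^sup>2 + 2 * (cmod (g x))\<^sup>2"
        using sum_squares_bound[of "cmod (f x)" "cmod (g x)"] by (simp add: power2_sum)
      finally show "norm ((cmod (f x + g x))\<^sup>2) \<le> norm (2 * (cmod (f x))\<^sup>2 + 2 * (cmod (g x))\<^sup>2)"
        by simp
    qed
  qed measurable
qed

lemma L2_cmult:
  assumes f: "f \<in> L2_space M"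
  shows "(\<lambda>x. c * f x) \<in> L2_space M"
proof (rule L2_spaceI)
  note [measurable] = L2_measurable[OF f]
  show "(\<lambda>x. c * f x) \<in> borel_measurable M" by measurable
  show "integrable M (\<lambda>x. (cmod (c * f x))\<^sup>2)"
    using L2_integrable_sq[OF f] by (simp add: norm_mult power_mult_distrib)
qed

lemma L2_diff:
  assumes "f \<in> L2_space M" and "g \<in> L2_space M"
  shows "(\<lambda>x. f x - g x) \<in> L2_space M"
  using L2_add[OF assms(1) L2_cmult[OF assms(2), of "-1"]] by simp

lemma L2_zero: "(\<lambda>x. 0) \<in> L2_space M"
  by (simp add: L2_space_def)

lemma L2_sum:
  assumes "\<And>i. i \<in> F \<Longrightarrow> f i \<in> L2_space M"
  shows "(\<lambda>x. \<Sum>i\<in>F. f i x) \<in> L2_space M"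
  using assms
  by (induction F rule: infinite_finite_induct) (auto simp: L2_zero intro: L2_add)

lemma L2_norm_nonneg: "0 \<le> L2_norm M f"
  by (simp add: L2_norm_def)

lemma L2_norm_sq: "(L2_norm M f)\<^sup>2 = (\<integral>x. (cmod (f x))\<^sup>2 \<partial>M)"
  by (simp add: L2_norm_def)

lemma L2_inner_self: "L2_inner M f f = of_real ((L2_norm M f)\<^sup>2)"
  by (simp add: L2_inner_def L2_norm_sq complex_norm_square[symmetric] del: of_real_power)

lemma L2_inner_commute: "L2_inner M g f = cnj (L2_inner M f g)"
  unfolding L2_inner_def Bochner_Integration.integral_cnj[symmetric] by (simp add: mult.commute)

lemma L2_inner_diff_left:
  assumes "f \<in> L2_space M" "g \<in> L2_space M" "h \<in> L2_space M"
  shows "L2_inner M (\<lambda>x. f x - g x) h = L2_inner M f h - L2_inner M g h"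
  unfolding L2_inner_def
  by (simp add: left_diff_distrib L2_integrable_mult assms)

lemma L2_inner_cmult_left: "L2_inner M (\<lambda>x. c * f x) h = c * L2_inner M f h"
  unfolding L2_inner_def by (simp add: mult.assoc)

lemma L2_inner_cmult_right: "L2_inner M f (\<lambda>x. c * h x) = cnj c * L2_inner M f h"
  unfolding L2_inner_commute[of M f] by (simp add: L2_inner_cmult_left)

lemma L2_inner_sum_left:
  assumes "\<And>i. i \<in> F \<Longrightarrow> f i \<in> L2_space M" "h \<in> L2_space M"
  shows "L2_inner M (\<lambda>x. \<Sum>i\<in>F. f i x) h = (\<Sum>i\<in>F. L2_inner M (f i) h)"
  unfolding L2_inner_def sum_distrib_right
  by (rule Bochner_Integration.integral_sum) (simp add: L2_integrable_mult assms)

lemma L2_inner_sum_right: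
  assumes "\<And>i. i \<in> F \<Longrightarrow> f i \<in> L2_space M" "h \<in> L2_space M"
  shows "L2_inner M h (\<lambda>x. \<Sum>i\<in>F. f i x) = (\<Sum>i\<in>F. L2_inner M h (f i))"
  by (subst L2_inner_commute, subst L2_inner_sum_left[OF assms])
     (simp_all add: L2_inner_commute[of M h])

lemma L2_norm_cong_AE:
  assumes "f \<in> borel_measurable M" "g \<in> borel_measurable M" "AE x in M. f x = g x"
  shows "L2_norm M f = L2_norm M g"
proof -
  note [measurable] = assms(1,2)
  have "(\<integral>x. (cmod (f x))\<^sup>2 \<partial>M) = (\<integral>x. (cmod (g x))\<^sup>2 \<partial>M)"
    using assms(3) by (intro integral_cong_AE) auto
  then show ?thesis by (simp add: L2_norm_def)
qed

lemma L2_inner_cong_AE: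
  assumes "f \<in> borel_measurable M" "g \<in> borel_measurable M" "AE x in M. f x = g x"
    and "h \<in> borel_measurable M" "k \<in> borel_measurable M" "AE x in M. h x = k x"
  shows "L2_inner M f h = L2_inner M g k"
proof -
  note [measurable] = assms(1,2,4,5)
  show ?thesis
    unfolding L2_inner_def using assms(3,6) by (intro integral_cong_AE) auto
qed

lemma L2_norm_eq_0_iff:
  assumes "f \<in> L2_space M"
  shows "L2_norm M f = 0 \<longleftrightarrow> (AE x in M. f x = 0)"
  unfolding L2_norm_def
  using integral_nonneg_eq_0_iff_AE[OF L2_integrable_sq[OF assms]] by simp

lemma L2_integral_mult_norm_le:
  assumes f: "f \<in> L2_space M" and g: "g \<in> L2_space M"
  shows "(\<integral>x. cmod (f x) * cmod (g x) \<partial>M) \<le> L2_norm M f * L2_norm M g"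
proof (cases "L2_norm M f = 0 \<or> L2_norm M g = 0")
  case True
  then have "AE x in M. cmod (f x) * cmod (g x) = 0"
    using L2_norm_eq_0_iff[OF f] L2_norm_eq_0_iff[OF g] by auto
  then have "(\<integral>x. cmod (f x) * cmod (g x) \<partial>M) = 0"
    by (rule integral_eq_zero_AE)
  then show ?thesis by (simp add: L2_norm_nonneg)
next
  case False
  \<comment> \<open>The weights make the arithmetic-geometric mean inequality sharp after integration.\<close>
  define a b where "a = L2_norm M f" and "b = L2_norm M g"
  have pos: "a > 0" "b > 0"
    using False L2_norm_nonneg[of M f] L2_norm_nonneg[of M g] by (auto simp: a_def b_def)
  have "(\<integral>x. cmod (f x) * cmod (g x) \<partial>M)
      \<le> (\<integral>x. b / (2 * a) * (cmod (f x))\<^sup>2 + a / (2 * b) * (cmod (g x))\<^sup>2 \<partial>M)"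
  proof (rule integral_mono)
    show "integrable M (\<lambda>x. b / (2 * a) * (cmod (f x))\<^sup>2 + a / (2 * b) * (cmod (g x))\<^sup>2)"
      using f g by (auto simp: L2_space_def)
    fix x
    have "0 \<le> (b * cmod (f x) - a * cmod (g x))\<^sup>2 / (2 * a * b)"
      using pos by simp
    also have "\<dots> = b / (2 * a) * (cmod (f x))\<^sup>2 + a / (2 * b) * (cmod (g x))\<^sup>2 - cmod (f x) * cmod (g x)"
      using pos by (simp add: field_simps power2_eq_square)
    finally show "cmod (f x) * cmod (g x) \<le> b / (2 * a) * (cmod (f x))\<^sup>2 + a / (2 * b) * (cmod (g x))\<^sup>2"
      by simp
  qed (rule L2_integrable_mult_norm[OF f g])
  also have "\<dots> = b / (2 * a) * a\<^sup>2 + a / (2 * b) * b\<^sup>2"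
    using L2_integrable_sq[OF f] L2_integrable_sq[OF g] by (simp add: a_def b_def L2_norm_sq)
  also have "\<dots> = a * b" using pos by (simp add: field_simps power2_eq_square)
  finally show ?thesis by (simp add: a_def b_def)
qed

lemma L2_Cauchy_Schwarz:
  assumes f: "f \<in> L2_space M" and g: "g \<in> L2_space M"
  shows "cmod (L2_inner M f g) \<le> L2_norm M f * L2_norm M g"
proof -
  have "cmod (L2_inner M f g) \<le> (\<integral>x. cmod (f x * cnj (g x)) \<partial>M)"
    unfolding L2_inner_def by (rule integral_norm_bound)
  then show ?thesis
    using L2_integral_mult_norm_le[OF f g] by (simp add: norm_mult)
qed

lemma L2_norm_add_sq:
  assumes f: "f \<in> L2_space M" and g: "g \<in> L2_space M"
  shows "(L2_norm M (\<lambda>x. f x + g x))\<^sup>2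
      = (L2_norm M f)\<^sup>2 + 2 * Re (L2_inner M f g) + (L2_norm M g)\<^sup>2"
proof -
  have "(L2_norm M (\<lambda>x. f x + g x))\<^sup>2
      = (\<integral>x. (cmod (f x))\<^sup>2 + 2 * Re (f x * cnj (g x)) + (cmod (g x))\<^sup>2 \<partial>M)"
    unfolding L2_norm_sq
    by (intro Bochner_Integration.integral_cong refl)
       (simp add: cmod_power2, simp add: power2_eq_square algebra_simps)
  also have "\<dots> = (L2_norm M f)\<^sup>2 + 2 * Re (L2_inner M f g) + (L2_norm M g)\<^sup>2"
    using L2_integrable_sq[OF f] L2_integrable_sq[OF g] L2_integrable_mult[OF f g]
    by (simp add: L2_norm_sq L2_inner_def integrable_Re del: times_complex.sel)
  finally show ?thesis .
qed

lemma L2_norm_cmult: "L2_norm M (\<lambda>x. c * f x) = cmod c * L2_norm M f"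
  by (simp add: L2_norm_def norm_mult power_mult_distrib real_sqrt_mult)

lemma L2_norm_diff_sq:
  assumes f: "f \<in> L2_space M" and g: "g \<in> L2_space M"
  shows "(L2_norm M (\<lambda>x. f x - g x))\<^sup>2
      = (L2_norm M f)\<^sup>2 - 2 * Re (L2_inner M f g) + (L2_norm M g)\<^sup>2"
  using L2_norm_add_sq[OF f L2_cmult[OF g, of "-1"]] L2_norm_cmult[of M "-1" g]
    L2_inner_cmult_right[of M f "-1" g] by simp

lemma L2_norm_triangle:
  assumes f: "f \<in> L2_space M" and g: "g \<in> L2_space M"
  shows "L2_norm M (\<lambda>x. f x + g x) \<le> L2_norm M f + L2_norm M g"
proof (rule power2_le_imp_le)
  have "Re (L2_inner M f g) \<le> L2_norm M f * L2_norm M g"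
    using L2_Cauchy_Schwarz[OF f g] complex_Re_le_cmod order_trans by blast
  then show "(L2_norm M (\<lambda>x. f x + g x))\<^sup>2 \<le> (L2_norm M f + L2_norm M g)\<^sup>2"
    unfolding L2_norm_add_sq[OF f g] by (simp add: power2_sum)
qed (simp add: L2_norm_nonneg)

lemma L2_norm_minus_commute: "L2_norm M (\<lambda>x. f x - g x) = L2_norm M (\<lambda>x. g x - f x)"
  by (simp add: L2_norm_def norm_minus_commute)

lemma L2_norm_diff_triangle:
  assumes "f \<in> L2_space M" "g \<in> L2_space M" "h \<in> L2_space M"
  shows "L2_norm M (\<lambda>x. f x - h x) \<le> L2_norm M (\<lambda>x. f x - g x) + L2_norm M (\<lambda>x. g x - h x)"
  using L2_norm_triangle[OF L2_diff[OF assms(1,2)] L2_diff[OF assms(2,3)]] by simp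

lemma L2_norm_reverse_triangle:
  assumes f: "f \<in> L2_space M" and g: "g \<in> L2_space M"
  shows "\<bar>L2_norm M f - L2_norm M g\<bar> \<le> L2_norm M (\<lambda>x. f x - g x)"
  using L2_norm_triangle[OF L2_diff[OF f g] g] L2_norm_triangle[OF L2_diff[OF g f] f]
    L2_norm_minus_commute[of M f g] by simp

lemma (in prob_space) L2_norm_le_sup:
  fixes f :: "'a \<Rightarrow> complex"
  assumes [measurable]: "f \<in> borel_measurable M" and C: "\<And>x. cmod (f x) \<le> C"
  shows "L2_norm M f \<le> C"
proof -
  have C0: "0 \<le> C" using C[of undefined] norm_ge_zero order_trans by blast
  have "(\<integral>x. (cmod (f x))\<^sup>2 \<partial>M) \<le> (\<integral>x. C\<^sup>2 \<partial>M)"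
    using L2_integrable_sq[OF L2_bounded[OF assms]] C
    by (intro integral_mono) (auto intro!: power_mono)
  then have "(L2_norm M f)\<^sup>2 \<le> C\<^sup>2" by (simp add: L2_norm_sq prob_space)
  then show ?thesis using C0 by (rule power2_le_imp_le)
qed

lemma L2_inner_tendsto:
  assumes u: "\<And>n. u n \<in> L2_space M" and h: "h \<in> L2_space M" and e: "e \<in> L2_space M"
    and lim: "(\<lambda>n. L2_norm M (\<lambda>x. u n x - h x)) \<longlonglongrightarrow> 0"
  shows "(\<lambda>n. L2_inner M (u n) e) \<longlonglongrightarrow> L2_inner M h e"
proof (rule LIM_zero_cancel, rule Lim_null_comparison)
  show "\<forall>\<^sub>F n in sequentially. norm (L2_inner M (u n) e - L2_inner M h e)
      \<le> L2_norm M (\<lambda>x. u n x - h x) * L2_norm M e"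
    using L2_Cauchy_Schwarz[OF L2_diff[OF u h] e] by (simp add: L2_inner_diff_left u h e)
  show "(\<lambda>n. L2_norm M (\<lambda>x. u n x - h x) * L2_norm M e) \<longlonglongrightarrow> 0"
    using tendsto_mult_right[OF lim, of "L2_norm M e"] by simp
qed

lemma L2_norm_tendsto:
  assumes u: "\<And>n. u n \<in> L2_space M" and h: "h \<in> L2_space M"
    and lim: "(\<lambda>n. L2_norm M (\<lambda>x. u n x - h x)) \<longlonglongrightarrow> 0"
  shows "(\<lambda>n. L2_norm M (u n)) \<longlonglongrightarrow> L2_norm M h"
  by (rule LIM_zero_cancel, rule Lim_null_comparison[OF _ lim])
     (simp add: L2_norm_reverse_triangle[OF u h])

lemma (in prob_space) L1_le_L2:
  assumes f: "f \<in> L2_space M"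
  shows "(\<integral>x. cmod (f x) \<partial>M) \<le> L2_norm M f"
proof -
  have "L2_norm M (\<lambda>x. 1) = 1" by (simp add: L2_norm_def prob_space)
  moreover have "(\<lambda>x. 1) \<in> L2_space M" by (rule L2_bounded[where C = 1]) auto
  ultimately show ?thesis
    using L2_integral_mult_norm_le[OF f, of "\<lambda>x. 1"] by simp
qed

text \<open>
  Along a subsequence with \<open>\<parallel>v\<^sub>i\<^sub>+\<^sub>1 - v\<^sub>i\<parallel> < 2\<^sup>-\<^sup>i\<close> the increments are absolutely summable almost
  everywhere, because their \<open>L\<^sup>1\<close> norms are; Fatou's lemma then shows that the pointwise limit is
  also the limit in norm.
\<close>
lemma (in prob_space) L2_complete:
  fixes u :: "nat \<Rightarrow> 'a \<Rightarrow> complex"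
  assumes u: "\<And>n. u n \<in> L2_space M"
    and cauchy: "\<And>e. e > 0 \<Longrightarrow> \<exists>N. \<forall>m\<ge>N. \<forall>n\<ge>N. L2_norm M (\<lambda>x. u m x - u n x) < e"
  obtains h where "h \<in> L2_space M" "(\<lambda>n. L2_norm M (\<lambda>x. u n x - h x)) \<longlonglongrightarrow> 0"
proof -
  have "\<forall>i. \<exists>N. \<forall>m\<ge>N. \<forall>n\<ge>N. L2_norm M (\<lambda>x. u m x - u n x) < (1/2)^i"
    using cauchy by simp
  then obtain N where N: "\<And>i m n. m \<ge> N i \<Longrightarrow> n \<ge> N i \<Longrightarrow> L2_norm M (\<lambda>x. u m x - u n x) < (1/2)^i"
    by metis
  \<comment> \<open>Summing makes the indices increasing while keeping them beyond every earlier \<open>N j\<close>.\<close>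
  define k where "k i = (\<Sum>j\<le>i. N j)" for i
  have kN: "k i \<ge> N j" if "j \<le> i" for i j
    unfolding k_def using that by (intro member_le_sum) auto
  define v where "v i = u (k i)" for i
  have vL2: "v i \<in> L2_space M" for i by (simp add: v_def u)
  have [measurable]: "u n \<in> borel_measurable M" "v n \<in> borel_measurable M" for n
    by (auto simp: v_def intro: L2_measurable[OF u])
  have AE_summable: "AE x in M. summable (\<lambda>i. cmod (v (Suc i) x - v i x))"
  proof -
    have "(\<integral>\<^sup>+x. (\<Sum>i. ennreal (cmod (v (Suc i) x - v i x))) \<partial>M)
        = (\<Sum>i. \<integral>\<^sup>+x. ennreal (cmod (v (Suc i) x - v i x)) \<partial>M)"
      by (rule nn_integral_suminf) measurable
    also have "\<dots> \<le> (\<Sum>i. ennreal ((1/2)^i))"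
    proof (rule suminf_le)
      fix i
      have d: "(\<lambda>x. v (Suc i) x - v i x) \<in> L2_space M" by (intro L2_diff vL2)
      have "(\<integral>\<^sup>+x. ennreal (cmod (v (Suc i) x - v i x)) \<partial>M)
          = ennreal (\<integral>x. cmod (v (Suc i) x - v i x) \<partial>M)"
        using L2_integrable_mult_norm[OF d L2_bounded[of "\<lambda>x. 1" 1]]
        by (intro nn_integral_eq_integral) auto
      also have "\<dots> \<le> ennreal ((1/2)^i)"
        using L1_le_L2[OF d] N[of i "k (Suc i)" "k i"] kN[of i i] kN[of i "Suc i"]
        by (intro ennreal_leI) (auto simp: v_def)
      finally show "(\<integral>\<^sup>+x. ennreal (cmod (v (Suc i) x - v i x)) \<partial>M) \<le> ennreal ((1/2)^i)" .
    qed auto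
    also have "\<dots> = ennreal (\<Sum>i. (1/2)^i)"
      by (intro suminf_ennreal2) (auto intro: summable_geometric)
    also have "\<dots> < \<infinity>" by simp
    finally have "AE x in M. (\<Sum>i. ennreal (cmod (v (Suc i) x - v i x))) \<noteq> \<infinity>"
      by (intro nn_integral_noteq_infinite) auto
    then show ?thesis
    proof eventually_elim
      case (elim x)
      then show ?case by (intro summable_suminf_not_top) auto
    qed
  qed
  define h where "h x = lim (\<lambda>i. v i x)" for x
  have [measurable]: "h \<in> borel_measurable M" unfolding h_def by measurable
  have AE_lim: "AE x in M. (\<lambda>i. v i x) \<longlonglongrightarrow> h x"
    using AE_summable
  proof eventually_elim
    case (elim x)
    then have "summable (\<lambda>i. v (Suc i) x - v i x)" by (rule summable_norm_cancel)
    then have "convergent (\<lambda>i. v 0 x + (\<Sum>j<i. v (Suc j) x - v j x))"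
      by (intro convergent_add convergent_const) (simp add: summable_iff_convergent)
    then have "convergent (\<lambda>i. v i x)"
      unfolding sum_lessThan_telescope[of "\<lambda>i. v i x"] by simp
    then show ?case unfolding h_def by (simp add: convergent_LIMSEQ_iff)
  qed
  have fatou: "(\<integral>\<^sup>+x. ennreal ((cmod (u n x - h x))\<^sup>2) \<partial>M) \<le> ennreal (((1/2)^i)\<^sup>2)"
    if n: "n \<ge> k i" for n i
  proof -
    have "(\<integral>\<^sup>+x. ennreal ((cmod (u n x - h x))\<^sup>2) \<partial>M)
        = (\<integral>\<^sup>+x. liminf (\<lambda>j. ennreal ((cmod (u n x - v j x))\<^sup>2)) \<partial>M)"
    proof (rule nn_integral_cong_AE)
      show "AE x in M. ennreal ((cmod (u n x - h x))\<^sup>2) = liminf (\<lambda>j. ennreal ((cmod (u n x - v j x))\<^sup>2))"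
        using AE_lim
      proof eventually_elim
        case (elim x)
        then have "(\<lambda>j. ennreal ((cmod (u n x - v j x))\<^sup>2)) \<longlonglongrightarrow> ennreal ((cmod (u n x - h x))\<^sup>2)"
          by (intro tendsto_ennrealI tendsto_intros)
        then show ?case by (intro lim_imp_Liminf[symmetric] sequentially_bot)
      qed
    qed
    also have "\<dots> \<le> liminf (\<lambda>j. \<integral>\<^sup>+x. ennreal ((cmod (u n x - v j x))\<^sup>2) \<partial>M)"
      by (rule nn_integral_liminf) measurable
    also have "\<dots> \<le> ennreal (((1/2)^i)\<^sup>2)"
    proof (rule Liminf_le)
      have "(\<integral>\<^sup>+x. ennreal ((cmod (u n x - v j x))\<^sup>2) \<partial>M) \<le> ennreal (((1/2)^i)\<^sup>2)" if "j \<ge> i" for j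
      proof -
        have d: "(\<lambda>x. u n x - v j x) \<in> L2_space M" by (intro L2_diff u vL2)
        have "(\<integral>\<^sup>+x. ennreal ((cmod (u n x - v j x))\<^sup>2) \<partial>M) = ennreal ((L2_norm M (\<lambda>x. u n x - v j x))\<^sup>2)"
          unfolding L2_norm_sq using L2_integrable_sq[OF d] by (intro nn_integral_eq_integral) auto
        also have "\<dots> \<le> ennreal (((1/2)^i)\<^sup>2)"
          using N[of i n "k j"] n kN[of i i] kN[OF that]
          by (intro ennreal_leI power_mono) (auto simp: v_def L2_norm_nonneg)
        finally show ?thesis .
      qed
      then show "\<forall>\<^sub>F j in sequentially. (\<integral>\<^sup>+x. ennreal ((cmod (u n x - v j x))\<^sup>2) \<partial>M) \<le> ennreal (((1/2)^i)\<^sup>2)"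
        unfolding eventually_sequentially by blast
    qed simp
    finally show ?thesis .
  qed
  have dL2: "(\<lambda>x. u n x - h x) \<in> L2_space M" if "n \<ge> k i" for n i
  proof (rule L2_spaceI)
    show "integrable M (\<lambda>x. (cmod (u n x - h x))\<^sup>2)"
      using le_less_trans[OF fatou[OF that]] by (intro integrableI_bounded) (auto simp: ennreal_less_top)
  qed measurable
  have hL2: "h \<in> L2_space M"
    using L2_diff[OF u[of "k 0"] dL2[of 0 "k 0"]] by simp
  have bound: "L2_norm M (\<lambda>x. u n x - h x) \<le> (1/2)^i" if "n \<ge> k i" for n i
  proof (rule power2_le_imp_le)
    have "ennreal ((L2_norm M (\<lambda>x. u n x - h x))\<^sup>2) = (\<integral>\<^sup>+x. ennreal ((cmod (u n x - h x))\<^sup>2) \<partial>M)"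
      unfolding L2_norm_sq using L2_integrable_sq[OF dL2[OF that]]
      by (intro nn_integral_eq_integral[symmetric]) auto
    also note fatou[OF that]
    finally show "(L2_norm M (\<lambda>x. u n x - h x))\<^sup>2 \<le> ((1/2)^i)\<^sup>2" by (simp add: ennreal_le_iff)
  qed simp
  have "(\<lambda>n. L2_norm M (\<lambda>x. u n x - h x)) \<longlonglongrightarrow> 0"
  proof (rule LIMSEQ_I)
    fix r :: real assume "r > 0"
    then obtain i where "(1/2)^i < r" using real_arch_pow_inv[of r "1/2"] by auto
    then show "\<exists>no. \<forall>n\<ge>no. norm (L2_norm M (\<lambda>x. u n x - h x) - 0) < r"
      using bound[of i] by (intro exI[of _ "k i"]) (auto simp: L2_norm_nonneg intro: le_less_trans)
  qed
  with hL2 show thesis by (rule that)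
qed

section \<open>Twisted ergodic averages\<close>

lemma norm_sum_shift_diff:
  fixes a :: "nat \<Rightarrow> complex"
  assumes "\<And>j. cmod (a j) \<le> C"
  shows "cmod ((\<Sum>j<n. a (j + h)) - (\<Sum>j<n. a j)) \<le> 2 * real h * C"
proof -
  have "(\<Sum>j<n + h. a j) = (\<Sum>j<h. a j) + (\<Sum>j<n. a (j + h))"
    by (induction n) (auto simp: add.commute)
  moreover have "(\<Sum>j<n + h. a j) = (\<Sum>j<n. a j) + (\<Sum>j<h. a (n + j))"
    by (induction h) auto
  ultimately have "(\<Sum>j<n. a (j + h)) - (\<Sum>j<n. a j) = (\<Sum>j<h. a (n + j)) - (\<Sum>j<h. a j)"
    by (simp add: algebra_simps)
  moreover have "cmod (\<Sum>j<h. a (n + j)) \<le> real h * C" "cmod (\<Sum>j<h. a j) \<le> real h * C"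
    using sum_norm_bound[of "{..<h}" "\<lambda>j. a (n + j)" C] sum_norm_bound[of "{..<h}" a C] assms
    by auto
  ultimately show ?thesis
    using norm_triangle_ineq4[of "\<Sum>j<h. a (n + j)" "\<Sum>j<h. a j"] by simp
qed

lemma norm_powi_eq_1: "cmod \<xi> = 1 \<Longrightarrow> cmod (\<xi> powi k) = 1"
  by (simp add: norm_power_int)

lemma powi_minus_add:
  fixes \<xi> :: complex
  assumes "cmod \<xi> = 1"
  shows "\<xi> powi (- int (j + h)) = \<xi> powi (- int j) * \<xi> powi (- int h)"
proof -
  have "\<xi> \<noteq> 0" using assms by auto
  then show ?thesis by (simp add: power_int_add[symmetric])
qed

lemma FB_avg_bound:
  assumes "cmod \<xi> = 1" and C: "\<And>y. cmod (f y) \<le> C"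
  shows "cmod (FB_avg T f \<xi> n x) \<le> C"
proof (cases "n = 0")
  case True
  have "0 \<le> C" using C[of undefined] norm_ge_zero order_trans by blast
  then show ?thesis using True by (simp add: FB_avg_def)
next
  case False
  have "cmod (\<Sum>j<n. \<xi> powi (- int j) * f ((T ^^ j) x)) \<le> real n * C"
    using sum_norm_bound[of "{..<n}" "\<lambda>j. \<xi> powi (- int j) * f ((T ^^ j) x)" C] assms
    by (simp add: norm_mult norm_powi_eq_1 del: power_int_minus)
  then show ?thesis
    using False by (simp add: FB_avg_def norm_mult norm_divide field_simps)
qed

lemma FB_avg_add: "FB_avg T (\<lambda>y. f y + g y) \<xi> n x = FB_avg T f \<xi> n x + FB_avg T g \<xi> n x"
  by (simp add: FB_avg_def ring_distribs sum.distrib)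

lemma FB_avg_diff: "FB_avg T (\<lambda>y. f y - g y) \<xi> n x = FB_avg T f \<xi> n x - FB_avg T g \<xi> n x"
  by (simp add: FB_avg_def ring_distribs sum_subtractf)

text \<open>
  Twisting makes the average of an average a double average of one sequence over the shifts
  \<open>j + h\<close>; a shift by \<open>h\<close> changes a sum over \<open>n\<close> bounded terms by at most \<open>2h\<close> terms.
\<close>
lemma FB_avg_FB_avg:
  assumes \<xi>: "cmod \<xi> = 1" and C: "\<And>y. cmod (f y) \<le> C" and m: "m > 0"
  shows "cmod (FB_avg T (FB_avg T f \<xi> m) \<xi> n x - FB_avg T f \<xi> n x) \<le> 2 * real m * C / real n"
proof -
  define a where "a j = \<xi> powi (- int j) * f ((T ^^ j) x)" for j
  have aC: "cmod (a j) \<le> C" for j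
    using C by (simp add: a_def norm_mult norm_powi_eq_1[OF \<xi>] del: power_int_minus)
  have C0: "0 \<le> C" using C[of undefined] norm_ge_zero order_trans by blast
  have "\<xi> powi (- int j) * FB_avg T f \<xi> m ((T ^^ j) x) = (1 / of_nat m) * (\<Sum>h<m. a (j + h))" for j
  proof -
    have "\<xi> powi (- int j) * (\<xi> powi (- int h) * f ((T ^^ h) ((T ^^ j) x))) = a (j + h)" for h
      unfolding a_def powi_minus_add[OF \<xi>] by (simp add: funpow_add[of h j] add.commute[of j h] mult.assoc)
    then show ?thesis
      unfolding FB_avg_def mult.left_commute[of "\<xi> powi (- int j)"] sum_distrib_left[of "\<xi> powi (- int j)"]
      by simp
  qed
  then have "FB_avg T (FB_avg T f \<xi> m) \<xi> n x
      = (1 / of_nat n) * (\<Sum>j<n. (1 / of_nat m) * (\<Sum>h<m. a (j + h)))"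
    by (subst FB_avg_def) (simp del: power_int_minus)
  also have "\<dots> = (1 / of_nat m) * (1 / of_nat n) * (\<Sum>h<m. \<Sum>j<n. a (j + h))"
    by (subst sum.swap) (simp add: sum_distrib_left mult.commute)
  finally have "FB_avg T (FB_avg T f \<xi> m) \<xi> n x - FB_avg T f \<xi> n x
      = (1 / of_nat m) * (1 / of_nat n) * (\<Sum>h<m. (\<Sum>j<n. a (j + h)) - (\<Sum>j<n. a j))"
    using m by (simp add: FB_avg_def a_def sum_subtractf right_diff_distrib)
  moreover have "cmod (\<Sum>h<m. (\<Sum>j<n. a (j + h)) - (\<Sum>j<n. a j)) \<le> real m * (2 * real m * C)"
  proof -
    have "cmod ((\<Sum>j<n. a (j + h)) - (\<Sum>j<n. a j)) \<le> 2 * real m * C" if "h < m" for h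
    proof -
      have "2 * real h * C \<le> 2 * real m * C"
        using that C0 by (intro mult_right_mono) auto
      with norm_sum_shift_diff[of a C h n] aC show ?thesis by (meson order_trans)
    qed
    then show ?thesis
      using sum_norm_bound[of "{..<m}" "\<lambda>h. (\<Sum>j<n. a (j + h)) - (\<Sum>j<n. a j)" "2 * real m * C"]
      by simp
  qed
  ultimately have "cmod (FB_avg T (FB_avg T f \<xi> m) \<xi> n x - FB_avg T f \<xi> n x)
      \<le> (1 / real m) * (1 / real n) * (real m * (2 * real m * C))"
    by (simp only: norm_mult norm_divide norm_one norm_of_nat) (intro mult_left_mono, auto)
  also have "\<dots> = 2 * real m * C / real n"
    using m by simp
  finally show ?thesis .
qed

text \<open>
  Composition with \<open>T\<close> shifts the twisted sequence by one place, up to the factor \<open>\<xi>\<close>.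
\<close>
lemma FB_avg_comp:
  assumes \<xi>: "cmod \<xi> = 1" and C: "\<And>y. cmod (f y) \<le> C"
  shows "cmod (FB_avg T f \<xi> n (T x) - \<xi> * FB_avg T f \<xi> n x) \<le> 2 * C / real n"
proof -
  define a where "a j = \<xi> powi (- int j) * f ((T ^^ j) x)" for j
  have aC: "cmod (a j) \<le> C" for j
    using C by (simp add: a_def norm_mult norm_powi_eq_1[OF \<xi>] del: power_int_minus)
  have \<xi>0: "\<xi> \<noteq> 0" using \<xi> by auto
  have "\<xi> * a (j + 1) = \<xi> powi (- int j) * f ((T ^^ j) (T x))" for j
  proof -
    have "\<xi> * \<xi> powi (- int (j + 1)) = \<xi> powi (- int j)"
      using powi_minus_add[OF \<xi>, of j 1] \<xi>0 by (simp add: power_int_minus)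
    then show ?thesis by (simp add: a_def funpow_swap1 mult.assoc[symmetric])
  qed
  then have "FB_avg T f \<xi> n (T x) = (1 / of_nat n) * (\<Sum>j<n. \<xi> * a (j + 1))"
    by (simp add: FB_avg_def)
  then have "FB_avg T f \<xi> n (T x) - \<xi> * FB_avg T f \<xi> n x
      = \<xi> * (1 / of_nat n) * ((\<Sum>j<n. a (j + 1)) - (\<Sum>j<n. a j))"
    by (simp add: FB_avg_def a_def sum_distrib_left[symmetric] right_diff_distrib)
  then have "cmod (FB_avg T f \<xi> n (T x) - \<xi> * FB_avg T f \<xi> n x)
      = cmod ((\<Sum>j<n. a (j + 1)) - (\<Sum>j<n. a j)) / real n"
    using \<xi> by (simp add: norm_mult norm_divide del: sum.lessThan_Suc sum_diff1_nat)
  also have "\<dots> \<le> 2 * real 1 * C / real n"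
    by (intro divide_right_mono norm_sum_shift_diff aC) auto
  finally show ?thesis by simp
qed

section \<open>The mean ergodic theorem for twisted averages\<close>

locale measure_preserving = prob_space M for M :: "'a measure" +
  fixes T :: "'a \<Rightarrow> 'a"
  assumes T_measurable [measurable]: "T \<in> measurable M M"
    and distr_T: "distr M M T = M"
begin

lemma funpow_T_measurable [measurable]: "T ^^ n \<in> measurable M M"
  by (induction n) (auto intro: measurable_comp)

lemma distr_funpow: "distr M M (T ^^ n) = M"
proof (induction n)
  case (Suc n)
  have "distr M M (T ^^ Suc n) = distr (distr M M (T ^^ n)) M T"
    by (subst distr_distr) (auto simp: comp_def)
  then show ?case unfolding Suc distr_T .
qed (simp add: distr_id)

lemma integral_funpow:
  fixes f :: "'a \<Rightarrow> 'b::{banach, second_countable_topology}"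
  assumes "f \<in> borel_measurable M"
  shows "(\<integral>x. f ((T ^^ n) x) \<partial>M) = (\<integral>x. f x \<partial>M)"
  using integral_distr[OF funpow_T_measurable[of n] assms] by (simp add: distr_funpow)

lemma integrable_funpow:
  fixes f :: "'a \<Rightarrow> 'b::{banach, second_countable_topology}"
  assumes "integrable M f"
  shows "integrable M (\<lambda>x. f ((T ^^ n) x))"
  using integrable_distr[OF funpow_T_measurable[of n], of f] assms by (simp add: distr_funpow)

lemma AE_funpow:
  assumes "AE x in M. P x"
  shows "AE x in M. P ((T ^^ n) x)"
proof (rule AE_distrD[OF funpow_T_measurable])
  show "AE x in distr M M (T ^^ n). P x" unfolding distr_funpow by (rule assms)
qed

lemma L2_funpow:
  assumes f: "f \<in> L2_space M"
  shows "(\<lambda>x. f ((T ^^ n) x)) \<in> L2_space M"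
proof (rule L2_spaceI)
  note [measurable] = L2_measurable[OF f]
  show "(\<lambda>x. f ((T ^^ n) x)) \<in> borel_measurable M" by measurable
  show "integrable M (\<lambda>x. (cmod (f ((T ^^ n) x)))\<^sup>2)"
    using integrable_funpow[OF L2_integrable_sq[OF f]] .
qed

lemma L2_norm_funpow:
  assumes f: "f \<in> L2_space M"
  shows "L2_norm M (\<lambda>x. f ((T ^^ n) x)) = L2_norm M f"
proof -
  note [measurable] = L2_measurable[OF f]
  show ?thesis
    unfolding L2_norm_def by (subst integral_funpow[of "\<lambda>x. (cmod (f x))\<^sup>2" n]) auto
qed

lemma L2_inner_funpow:
  assumes f: "f \<in> L2_space M" and g: "g \<in> L2_space M"
  shows "L2_inner M (\<lambda>x. f ((T ^^ n) x)) (\<lambda>x. g ((T ^^ n) x)) = L2_inner M f g"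
proof -
  note [measurable] = L2_measurable[OF f] L2_measurable[OF g]
  show ?thesis
    unfolding L2_inner_def by (subst integral_funpow[of "\<lambda>x. f x * cnj (g x)" n]) auto
qed

lemma FB_avg_measurable [measurable (raw)]:
  assumes [measurable]: "f \<in> borel_measurable M"
  shows "FB_avg T f \<xi> n \<in> borel_measurable M"
  unfolding FB_avg_def by measurable

lemma L2_FB_avg:
  assumes f: "f \<in> L2_space M"
  shows "FB_avg T f \<xi> n \<in> L2_space M"
  unfolding FB_avg_def by (intro L2_cmult L2_sum L2_funpow f)

lemma L2_norm_FB_avg_le:
  assumes f: "f \<in> L2_space M" and \<xi>: "cmod \<xi> = 1"
  shows "L2_norm M (FB_avg T f \<xi> n) \<le> L2_norm M f"
proof -
  have "L2_norm M (\<lambda>x. \<Sum>j<k. \<xi> powi (- int j) * f ((T ^^ j) x)) \<le> real k * L2_norm M f" for k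
  proof (induction k)
    case (Suc k)
    have "L2_norm M (\<lambda>x. (\<Sum>j<k. \<xi> powi (- int j) * f ((T ^^ j) x)) + \<xi> powi (- int k) * f ((T ^^ k) x))
        \<le> L2_norm M (\<lambda>x. \<Sum>j<k. \<xi> powi (- int j) * f ((T ^^ j) x))
          + L2_norm M (\<lambda>x. \<xi> powi (- int k) * f ((T ^^ k) x))"
      by (intro L2_norm_triangle L2_sum L2_cmult L2_funpow f)
    also have "L2_norm M (\<lambda>x. \<xi> powi (- int k) * f ((T ^^ k) x)) = L2_norm M f"
      by (simp only: L2_norm_cmult L2_norm_funpow[OF f] norm_powi_eq_1[OF \<xi>])
    finally show ?case using Suc by (simp add: algebra_simps del: power_int_minus)
  qed (simp add: L2_norm_def)
  from this[of n] show ?thesis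
    unfolding FB_avg_def L2_norm_cmult
    by (cases "n = 0") (simp_all add: norm_divide field_simps L2_norm_nonneg del: power_int_minus)
qed

text \<open>
  The twist cancels against the eigenvalue: \<open>\<langle>\<xi>\<^sup>-\<^sup>j f \<circ> T\<^sup>j, e\<rangle> = \<langle>f \<circ> T\<^sup>j, e \<circ> T\<^sup>j\<rangle> = \<langle>f, e\<rangle>\<close>.
\<close>
lemma L2_inner_FB_avg:
  assumes f: "f \<in> L2_space M" and e: "e \<in> L2_space M" and \<xi>: "cmod \<xi> = 1"
    and eig: "AE x in M. e (T x) = \<xi> * e x" and n: "n > 0"
  shows "L2_inner M (FB_avg T f \<xi> n) e = L2_inner M f e"
proof -
  have pow: "AE x in M. e ((T ^^ j) x) = \<xi> ^ j * e x" for j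
  proof (induction j)
    case (Suc j)
    with AE_funpow[OF eig, of j] show ?case
      by eventually_elim (simp add: mult.assoc)
  qed simp
  have \<xi>0: "\<xi> \<noteq> 0" using \<xi> by auto
  have "L2_inner M (\<lambda>x. \<xi> powi (- int j) * f ((T ^^ j) x)) e = L2_inner M f e" for j
  proof -
    have "L2_inner M (\<lambda>x. \<xi> powi (- int j) * f ((T ^^ j) x)) e
        = L2_inner M (\<lambda>x. \<xi> powi (- int j) * f ((T ^^ j) x)) (\<lambda>x. \<xi> powi (- int j) * e ((T ^^ j) x))"
    proof (rule L2_inner_cong_AE)
      show "AE x in M. e x = \<xi> powi (- int j) * e ((T ^^ j) x)"
        using pow[of j] by eventually_elim (simp add: power_int_minus \<xi>0)
    qed (use L2_measurable[OF L2_cmult[OF L2_funpow[OF f]]] L2_measurable[OF e]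
         L2_measurable[OF L2_cmult[OF L2_funpow[OF e]]] in auto)
    also have "\<dots> = \<xi> powi (- int j) * cnj (\<xi> powi (- int j)) * L2_inner M f e"
      unfolding L2_inner_cmult_left L2_inner_cmult_right L2_inner_funpow[OF f e] by simp
    also have "\<xi> powi (- int j) * cnj (\<xi> powi (- int j)) = 1"
      by (simp only: complex_norm_square[symmetric] norm_powi_eq_1[OF \<xi>]) simp
    finally show ?thesis by simp
  qed
  then show ?thesis
    unfolding FB_avg_def L2_inner_cmult_left using n
    by (subst L2_inner_sum_left)
       (auto intro!: L2_cmult L2_funpow f e simp: L2_inner_cmult_left simp del: power_int_minus)
qed

text \<open>
  For bounded \<open>f\<close> and \<open>|\<xi>| = 1\<close> this limit exists and is the orthogonal projection of \<open>f\<close> to the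
  eigenspace of \<open>\<xi>\<close>.
\<close>
definition eigen_part :: "complex \<Rightarrow> ('a \<Rightarrow> complex) \<Rightarrow> 'a \<Rightarrow> complex" where
  "eigen_part \<xi> f = (SOME h. h \<in> L2_space M \<and>
     (\<lambda>n. L2_norm M (\<lambda>x. FB_avg T f \<xi> n x - h x)) \<longlonglongrightarrow> 0)"

context
  fixes f :: "'a \<Rightarrow> complex" and C :: real
  assumes f [measurable]: "f \<in> borel_measurable M" and C: "\<And>x. cmod (f x) \<le> C"
begin

private lemma f_L2: "f \<in> L2_space M"
  by (rule L2_bounded[OF f C])

text \<open>
  Averaging again does not increase the norm and changes \<open>A\<^sub>m f + A\<^sub>k f\<close> into nearly \<open>2 A\<^sub>n f\<close>.
\<close>
private lemma L2_norm_FB_avg_add_ge: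
  assumes \<xi>: "cmod \<xi> = 1" and mk: "m > 0" "k > 0"
  shows "2 * L2_norm M (FB_avg T f \<xi> n)
     \<le> L2_norm M (\<lambda>x. FB_avg T f \<xi> m x + FB_avg T f \<xi> k x) + 2 * real (m + k) * C / real n"
proof -
  define s where "s = (\<lambda>x. FB_avg T f \<xi> m x + FB_avg T f \<xi> k x)"
  note [simp] = L2_FB_avg[OF f_L2]
  have s: "s \<in> L2_space M" unfolding s_def by (intro L2_add) auto
  have "2 * L2_norm M (FB_avg T f \<xi> n) = L2_norm M (\<lambda>x. 2 * FB_avg T f \<xi> n x)"
    by (simp add: L2_norm_cmult)
  also have "\<dots> \<le> L2_norm M (FB_avg T s \<xi> n)
      + L2_norm M (\<lambda>x. 2 * FB_avg T f \<xi> n x - FB_avg T s \<xi> n x)"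
    using L2_norm_triangle[OF L2_FB_avg[OF s] L2_diff[OF L2_cmult L2_FB_avg[OF s]],
        of "FB_avg T f \<xi> n" \<xi> n 2 \<xi> n] by simp
  also have "L2_norm M (FB_avg T s \<xi> n) \<le> L2_norm M s"
    by (rule L2_norm_FB_avg_le[OF s \<xi>])
  also have "L2_norm M (\<lambda>x. 2 * FB_avg T f \<xi> n x - FB_avg T s \<xi> n x) \<le> 2 * real (m + k) * C / real n"
  proof (rule L2_norm_le_sup)
    show "(\<lambda>x. 2 * FB_avg T f \<xi> n x - FB_avg T s \<xi> n x) \<in> borel_measurable M"
      by (intro L2_measurable L2_diff L2_cmult L2_FB_avg s f_L2)
    fix x
    have "2 * FB_avg T f \<xi> n x - FB_avg T s \<xi> n x
        = - ((FB_avg T (FB_avg T f \<xi> m) \<xi> n x - FB_avg T f \<xi> n x)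
           + (FB_avg T (FB_avg T f \<xi> k) \<xi> n x - FB_avg T f \<xi> n x))"
      by (simp add: s_def FB_avg_add)
    then have "cmod (2 * FB_avg T f \<xi> n x - FB_avg T s \<xi> n x)
        \<le> cmod (FB_avg T (FB_avg T f \<xi> m) \<xi> n x - FB_avg T f \<xi> n x)
         + cmod (FB_avg T (FB_avg T f \<xi> k) \<xi> n x - FB_avg T f \<xi> n x)"
      by (simp only: norm_minus_cancel norm_triangle_ineq)
    also have "\<dots> \<le> 2 * real m * C / real n + 2 * real k * C / real n"
      by (intro add_mono FB_avg_FB_avg \<xi> C mk)
    also have "\<dots> = 2 * real (m + k) * C / real n"
      by (simp add: add_divide_distrib ring_distribs)
    finally show "cmod (2 * FB_avg T f \<xi> n x - FB_avg T s \<xi> n x) \<le> 2 * real (m + k) * C / real n" .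
  qed
  finally show ?thesis by (simp add: s_def)
qed

text \<open>
  The norms of the averages tend to their infimum \<open>d\<close>, and \<open>\<parallel>A\<^sub>m f + A\<^sub>k f\<parallel> \<ge> 2 d\<close>; the
  parallelogram law turns this into the Cauchy property.
\<close>
private lemma FB_avg_L2_Cauchy:
  assumes \<xi>: "cmod \<xi> = 1" and e: "e > 0"
  shows "\<exists>N. \<forall>m\<ge>N. \<forall>k\<ge>N. L2_norm M (\<lambda>x. FB_avg T f \<xi> m x - FB_avg T f \<xi> k x) < e"
proof -
  define a where "a n = L2_norm M (FB_avg T f \<xi> n)" for n
  have a0: "0 \<le> a n" for n by (simp add: a_def L2_norm_nonneg)
  define d where "d = (INF n\<in>{0<..}. a n)"
  have bdd: "bdd_below (a ` {0<..})" by (rule bdd_belowI[of _ 0]) (auto simp: a0)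
  have d_le: "d \<le> a n" if "n > 0" for n
    unfolding d_def using that by (intro cINF_lower bdd) auto
  have d0: "0 \<le> d" unfolding d_def by (intro cINF_greatest) (auto simp: a0)
  have small: "\<forall>\<^sub>F n in sequentially. 2 * real q * C / real n < \<epsilon>" if "\<epsilon> > 0" for q \<epsilon>
  proof -
    have "(\<lambda>n. 2 * real q * C / real n) \<longlonglongrightarrow> 0"
      by (rule lim_const_over_n)
    then show ?thesis using that by (rule order_tendstoD)
  qed
  have sum_ge: "2 * d \<le> L2_norm M (\<lambda>x. FB_avg T f \<xi> m x + FB_avg T f \<xi> k x)" (is "_ \<le> ?s")
    if "m > 0" "k > 0" for m k
  proof (rule field_le_epsilon)
    fix \<epsilon> :: real assume "\<epsilon> > 0"
    have "\<forall>\<^sub>F n in sequentially. n > 0" by (rule eventually_gt_at_top)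
    then have "\<forall>\<^sub>F n in sequentially. 2 * d \<le> ?s + \<epsilon>"
      using small[OF \<open>\<epsilon> > 0\<close>, of "m + k"]
    proof eventually_elim
      case (elim n)
      then show ?case
        using L2_norm_FB_avg_add_ge[OF \<xi> that, of n] d_le[of n] by (simp add: a_def)
    qed
    then show "2 * d \<le> ?s + \<epsilon>" by simp
  qed
  have lim: "a \<longlonglongrightarrow> d"
  proof (rule order_tendstoI)
    fix l assume "l < d"
    show "\<forall>\<^sub>F n in sequentially. l < a n"
      using eventually_gt_at_top[of 0]
    proof eventually_elim
      case (elim n)
      with d_le[of n] \<open>l < d\<close> show ?case by linarith
    qed
  next
    fix u assume "d < u"
    then obtain m where m: "m > 0" "a m < u"
      unfolding d_def using cINF_less_iff[OF _ bdd] by auto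
    show "\<forall>\<^sub>F n in sequentially. a n < u"
    proof -
      have "0 < 2 * (u - a m)" using m(2) by simp
      from small[OF this, of "m + m"] show ?thesis
      proof eventually_elim
        case (elim n)
        have "L2_norm M (\<lambda>x. FB_avg T f \<xi> m x + FB_avg T f \<xi> m x) = 2 * a m"
          using L2_norm_cmult[of M 2 "FB_avg T f \<xi> m"] by (simp add: a_def)
        with elim L2_norm_FB_avg_add_ge[OF \<xi> m(1) m(1), of n] show ?case
          by (simp add: a_def)
      qed
    qed
  qed
  have "(\<lambda>n. (a n)\<^sup>2) \<longlonglongrightarrow> d\<^sup>2" by (intro tendsto_intros lim)
  then have "\<forall>\<^sub>F n in sequentially. (a n)\<^sup>2 < d\<^sup>2 + e\<^sup>2 / 4"
    by (rule order_tendstoD) (use e in auto)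
  then obtain N where N: "\<And>n. n \<ge> N \<Longrightarrow> (a n)\<^sup>2 < d\<^sup>2 + e\<^sup>2 / 4"
    unfolding eventually_sequentially by blast
  show ?thesis
  proof (intro exI[of _ "Suc N"] allI impI)
    fix m k assume mk: "Suc N \<le> m" "Suc N \<le> k"
    define x y where "x = FB_avg T f \<xi> m" and "y = FB_avg T f \<xi> k"
    have xy: "x \<in> L2_space M" "y \<in> L2_space M" by (auto simp: x_def y_def L2_FB_avg f_L2)
    have "(2 * d)\<^sup>2 \<le> (L2_norm M (\<lambda>z. x z + y z))\<^sup>2"
      unfolding x_def y_def using mk d0 by (intro power_mono sum_ge) auto
    moreover have "(L2_norm M (\<lambda>z. x z - y z))\<^sup>2
        = 2 * (L2_norm M x)\<^sup>2 + 2 * (L2_norm M y)\<^sup>2 - (L2_norm M (\<lambda>z. x z + y z))\<^sup>2"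
      using L2_norm_add_sq[OF xy] L2_norm_diff_sq[OF xy] by simp
    moreover have "(L2_norm M x)\<^sup>2 < d\<^sup>2 + e\<^sup>2 / 4" "(L2_norm M y)\<^sup>2 < d\<^sup>2 + e\<^sup>2 / 4"
      using N[of m] N[of k] mk by (auto simp: a_def x_def y_def)
    ultimately have "(L2_norm M (\<lambda>z. x z - y z))\<^sup>2 < e\<^sup>2"
      by (simp add: power_mult_distrib)
    then have "L2_norm M (\<lambda>z. x z - y z) < e"
      by (rule power2_less_imp_less) (use e in auto)
    then show "L2_norm M (\<lambda>z. FB_avg T f \<xi> m z - FB_avg T f \<xi> k z) < e"
      by (simp add: x_def y_def)
  qed
qed

lemma eigen_part_lim:
  assumes \<xi>: "cmod \<xi> = 1"
  shows eigen_part_L2: "eigen_part \<xi> f \<in> L2_space M"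
    and FB_avg_L2_lim: "(\<lambda>n. L2_norm M (\<lambda>x. FB_avg T f \<xi> n x - eigen_part \<xi> f x)) \<longlonglongrightarrow> 0"
proof -
  have "\<exists>h. h \<in> L2_space M \<and> (\<lambda>n. L2_norm M (\<lambda>x. FB_avg T f \<xi> n x - h x)) \<longlonglongrightarrow> 0"
    using L2_complete[OF L2_FB_avg[OF f_L2] FB_avg_L2_Cauchy[OF \<xi>]] by blast
  from someI_ex[OF this] show "eigen_part \<xi> f \<in> L2_space M"
    "(\<lambda>n. L2_norm M (\<lambda>x. FB_avg T f \<xi> n x - eigen_part \<xi> f x)) \<longlonglongrightarrow> 0"
    unfolding eigen_part_def by auto
qed

lemma L2_norm_FB_avg_lim:
  assumes \<xi>: "cmod \<xi> = 1"
  shows "(\<lambda>n. L2_norm M (FB_avg T f \<xi> n)) \<longlonglongrightarrow> L2_norm M (eigen_part \<xi> f)"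
  by (rule L2_norm_tendsto[OF L2_FB_avg[OF f_L2] eigen_part_lim[OF \<xi>]])

text \<open>
  The relation holds for the averages up to a uniform error of order \<open>1 / n\<close> and passes to the
  limit, since composition with \<open>T\<close> is an isometry.
\<close>
lemma eigen_part_eigen:
  assumes \<xi>: "cmod \<xi> = 1"
  shows "AE x in M. eigen_part \<xi> f (T x) = \<xi> * eigen_part \<xi> f x"
proof -
  define h where "h = eigen_part \<xi> f"
  have h: "h \<in> L2_space M" by (simp add: h_def eigen_part_L2[OF \<xi>])
  have hT: "(\<lambda>x. h (T x)) \<in> L2_space M" using L2_funpow[OF h, of 1] by simp
  define A where "A n = FB_avg T f \<xi> n" for n
  have A: "A n \<in> L2_space M" for n by (simp add: A_def L2_FB_avg f_L2)
  have AT: "(\<lambda>x. A n (T x)) \<in> L2_space M" for n using L2_funpow[OF A, of n 1] by simp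
  have le: "L2_norm M (\<lambda>x. h (T x) - \<xi> * h x) \<le> 2 * L2_norm M (\<lambda>x. A n x - h x) + 2 * C / real n" for n
  proof -
    have "L2_norm M (\<lambda>x. h (T x) - \<xi> * h x)
        \<le> L2_norm M (\<lambda>x. h (T x) - A n (T x)) + L2_norm M (\<lambda>x. A n (T x) - \<xi> * h x)"
      by (intro L2_norm_diff_triangle hT AT L2_cmult h)
    also have "L2_norm M (\<lambda>x. A n (T x) - \<xi> * h x)
        \<le> L2_norm M (\<lambda>x. A n (T x) - \<xi> * A n x) + L2_norm M (\<lambda>x. \<xi> * A n x - \<xi> * h x)"
      by (intro L2_norm_diff_triangle AT L2_cmult A h)
    also have "L2_norm M (\<lambda>x. \<xi> * A n x - \<xi> * h x) = L2_norm M (\<lambda>x. A n x - h x)"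
      using L2_norm_cmult[of M \<xi> "\<lambda>x. A n x - h x"] \<xi> by (simp add: right_diff_distrib)
    also have "L2_norm M (\<lambda>x. h (T x) - A n (T x)) = L2_norm M (\<lambda>x. A n x - h x)"
      using L2_norm_funpow[OF L2_diff[OF h A], of 1 n] L2_norm_minus_commute[of M h "A n"] by simp
    also have "L2_norm M (\<lambda>x. A n (T x) - \<xi> * A n x) \<le> 2 * C / real n"
      by (intro L2_norm_le_sup L2_measurable L2_diff AT L2_cmult A)
         (unfold A_def, rule FB_avg_comp[OF \<xi> C])
    finally show ?thesis by simp
  qed
  have "(\<lambda>n. 2 * L2_norm M (\<lambda>x. A n x - h x) + 2 * C / real n) \<longlonglongrightarrow> 2 * 0 + 0"
    unfolding A_def h_def by (intro tendsto_intros FB_avg_L2_lim[OF \<xi>] lim_const_over_n)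
  then have "L2_norm M (\<lambda>x. h (T x) - \<xi> * h x) \<le> 2 * 0 + 0"
    by (rule LIMSEQ_le_const) (rule exI[of _ 0], intro allI impI le)
  then have "L2_norm M (\<lambda>x. h (T x) - \<xi> * h x) = 0"
    using L2_norm_nonneg[of M "\<lambda>x. h (T x) - \<xi> * h x"] by simp
  then show ?thesis
    by (simp add: L2_norm_eq_0_iff L2_diff L2_cmult h hT h_def[symmetric])
qed

text \<open>
  This makes \<open>f\<close> minus its eigenpart orthogonal to the eigenspace.
\<close>
lemma L2_inner_eigen_part:
  assumes \<xi>: "cmod \<xi> = 1" and e: "e \<in> L2_space M" and eig: "AE x in M. e (T x) = \<xi> * e x"
  shows "L2_inner M (eigen_part \<xi> f) e = L2_inner M f e"
proof -
  have "(\<lambda>n. L2_inner M (FB_avg T f \<xi> n) e) \<longlonglongrightarrow> L2_inner M (eigen_part \<xi> f) e"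
    by (rule L2_inner_tendsto[OF L2_FB_avg[OF f_L2] eigen_part_L2[OF \<xi>] e FB_avg_L2_lim[OF \<xi>]])
  moreover have "\<forall>\<^sub>F n in sequentially. L2_inner M (FB_avg T f \<xi> n) e = L2_inner M f e"
    using eventually_gt_at_top[of 0]
    by eventually_elim (rule L2_inner_FB_avg[OF f_L2 e \<xi> eig])
  ultimately have "(\<lambda>n. L2_inner M f e) \<longlonglongrightarrow> L2_inner M (eigen_part \<xi> f) e"
    by (rule Lim_transform_eventually)
  then show ?thesis by (simp add: LIMSEQ_const_iff)
qed

lemma L2_inner_eigen_part_self:
  assumes \<xi>: "cmod \<xi> = 1"
  shows "L2_inner M f (eigen_part \<xi> f) = of_real ((L2_norm M (eigen_part \<xi> f))\<^sup>2)"
  using L2_inner_eigen_part[OF \<xi> eigen_part_L2[OF \<xi>] eigen_part_eigen[OF \<xi>]]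
  by (simp add: L2_inner_self)

end

end

section \<open>The projection to the Kronecker subspace\<close>

lemma sum_in_complex_span:
  assumes "finite F" and "\<And>i. i \<in> F \<Longrightarrow> g i \<in> E" and "inj_on g F"
  shows "(\<lambda>x. \<Sum>i\<in>F. g i x) \<in> complex_span E"
proof -
  have "(\<lambda>x. \<Sum>i\<in>F. g i x) = (\<lambda>x. \<Sum>k\<in>g ` F. 1 * k x)"
    using assms(3) by (simp add: sum.reindex)
  then show ?thesis
    unfolding complex_span_def using assms(1,2)
    by (intro CollectI exI[of _ "\<lambda>_. 1"] exI[of _ "g ` F"]) auto
qed

lemma L2_pythagoras:
  assumes F: "finite F" and g: "\<And>i. i \<in> F \<Longrightarrow> g i \<in> L2_space M"
    and orth: "\<And>i j. i \<in> F \<Longrightarrow> j \<in> F \<Longrightarrow> i \<noteq> j \<Longrightarrow> L2_inner M (g i) (g j) = 0"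
  shows "(L2_norm M (\<lambda>x. \<Sum>i\<in>F. g i x))\<^sup>2 = (\<Sum>i\<in>F. (L2_norm M (g i))\<^sup>2)"
proof -
  have "complex_of_real ((L2_norm M (\<lambda>x. \<Sum>i\<in>F. g i x))\<^sup>2) = (\<Sum>i\<in>F. \<Sum>j\<in>F. L2_inner M (g i) (g j))"
    unfolding L2_inner_self[symmetric] using g
    by (simp add: L2_inner_sum_left L2_inner_sum_right L2_sum cong: sum.cong)
  also have "\<dots> = (\<Sum>i\<in>F. L2_inner M (g i) (g i))"
    using F orth by (intro sum.cong refl) (auto simp: sum.remove intro!: sum.neutral)
  also have "\<dots> = complex_of_real (\<Sum>i\<in>F. (L2_norm M (g i))\<^sup>2)"
    by (simp add: L2_inner_self del: of_real_power)
  finally show ?thesis by (simp only: of_real_eq_iff)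
qed

text \<open>
  The chosen projection \<open>k\<close> may differ from \<open>g\<close>, but testing \<open>f - g\<close> and \<open>f - k\<close> against \<open>g\<close> and
  \<open>k\<close> shows that \<open>\<parallel>g\<parallel>\<^sup>2\<close> and \<open>\<parallel>k\<parallel>\<^sup>2\<close> both equal the inner product of \<open>g\<close> with \<open>k\<close>.
\<close>
lemma L2_norm_orth_proj:
  assumes K: "K \<subseteq> L2_space M" and f: "f \<in> L2_space M" and g: "g \<in> K"
    and orth: "\<And>h. h \<in> K \<Longrightarrow> L2_inner M (\<lambda>x. f x - g x) h = 0"
  shows "L2_norm M (orth_proj M K f) = L2_norm M g"
proof -
  define k where "k = orth_proj M K f"
  have "k \<in> K \<and> (\<forall>h\<in>K. L2_inner M (\<lambda>x. f x - k x) h = 0)"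
    unfolding k_def orth_proj_def by (rule someI[of _ g]) (use g orth in auto)
  then have k: "k \<in> K" "\<And>h. h \<in> K \<Longrightarrow> L2_inner M f h = L2_inner M k h"
    using K f by (auto simp: L2_inner_diff_left subset_eq)
  have g': "L2_inner M f h = L2_inner M g h" if "h \<in> K" for h
    using orth[OF that] K f g that by (auto simp: L2_inner_diff_left subset_eq)
  have "L2_inner M k k = L2_inner M g k" using k(2)[OF k(1)] g'[OF k(1)] by simp
  also have "\<dots> = cnj (L2_inner M k g)" by (rule L2_inner_commute)
  also have "L2_inner M k g = L2_inner M g g" using k(2)[OF g] g'[OF g] by simp
  finally have "complex_of_real ((L2_norm M k)\<^sup>2) = complex_of_real ((L2_norm M g)\<^sup>2)"
    unfolding L2_inner_self by simp
  then have "(L2_norm M k)\<^sup>2 = (L2_norm M g)\<^sup>2" by (simp only: of_real_eq_iff)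
  then show ?thesis
    using L2_norm_nonneg[of M k] L2_norm_nonneg[of M g] by (simp add: k_def)
qed

lemma orthogonal_to_closure:
  assumes V: "V \<subseteq> L2_space M" and f: "f \<in> L2_space M" and orth: "\<And>h. h \<in> V \<Longrightarrow> L2_inner M f h = 0"
    and k: "k \<in> L2_closure M V"
  shows "L2_inner M f k = 0"
proof -
  have kL2: "k \<in> L2_space M" using k by (simp add: L2_closure_def)
  have "cmod (L2_inner M f k) \<le> 0 + e" if e: "e > 0" for e
  proof -
    have "e / (L2_norm M f + 1) > 0" using e L2_norm_nonneg[of M f] by simp
    then obtain h where h: "h \<in> V" "L2_norm M (\<lambda>x. k x - h x) < e / (L2_norm M f + 1)"
      using k unfolding L2_closure_def by blast
    then have hL2: "h \<in> L2_space M" using V by auto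
    have "L2_inner M f k = cnj (L2_inner M (\<lambda>x. k x - h x) f)"
      using orth[OF h(1)] L2_inner_commute[of M f h] L2_inner_commute[of M k f]
      by (simp add: L2_inner_diff_left kL2 hL2 f)
    then have "cmod (L2_inner M f k) \<le> L2_norm M (\<lambda>x. k x - h x) * L2_norm M f"
      using L2_Cauchy_Schwarz[OF L2_diff[OF kL2 hL2] f] by simp
    also have "\<dots> \<le> e / (L2_norm M f + 1) * (L2_norm M f + 1)"
      using h(2) L2_norm_nonneg[of M f] e by (intro mult_mono) auto
    also have "\<dots> = 0 + e" using L2_norm_nonneg[of M f] by simp
    finally show ?thesis .
  qed
  then have "cmod (L2_inner M f k) \<le> 0" by (rule field_le_epsilon)
  then show ?thesis by simp
qed

lemma orthogonal_to_span:
  assumes E: "E \<subseteq> L2_space M" and f: "f \<in> L2_space M" and orth: "\<And>h. h \<in> E \<Longrightarrow> L2_inner M f h = 0"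
    and k: "k \<in> complex_span E"
  shows "L2_inner M f k = 0"
proof -
  obtain F c where F: "F \<subseteq> E" and k_eq: "k = (\<lambda>x. \<Sum>g\<in>F. c g * g x)"
    using k unfolding complex_span_def by blast
  have "L2_inner M f k = (\<Sum>g\<in>F. L2_inner M f (\<lambda>x. c g * g x))"
    unfolding k_eq using E F by (intro L2_inner_sum_right L2_cmult f) auto
  also have "\<dots> = 0" using F orth by (intro sum.neutral) (auto simp: L2_inner_cmult_right)
  finally show ?thesis .
qed

lemma complex_span_subset:
  assumes "E \<subseteq> L2_space M"
  shows "complex_span E \<subseteq> L2_space M"
  unfolding complex_span_def using assms by (auto intro!: L2_sum L2_cmult)

lemma eigenfunctions_subset: "eigenfunctions T M \<subseteq> L2_space M"
  by (auto simp: eigenfunctions_def)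

context measure_preserving
begin

text \<open>
  Composition with \<open>T\<close> preserves the norm, which is positive on eigenfunctions.
\<close>
lemma eigenfunction_eigenvalue:
  assumes "e \<in> eigenfunctions T M"
  obtains c where "cmod c = 1" "AE x in M. e (T x) = c * e x"
proof -
  from assms obtain c where e: "e \<in> L2_space M" "\<not> (AE x in M. e x = 0)"
    and c: "AE x in M. e (T x) = c * e x"
    unfolding eigenfunctions_def koopman_def by auto
  have "L2_norm M e = L2_norm M (\<lambda>x. e (T x))" using L2_norm_funpow[OF e(1), of 1] by simp
  also have "\<dots> = L2_norm M (\<lambda>x. c * e x)"
    using L2_measurable[OF L2_funpow[OF e(1), of 1]] L2_measurable[OF L2_cmult[OF e(1)]] c
    by (intro L2_norm_cong_AE) auto
  also have "\<dots> = cmod c * L2_norm M e" by (rule L2_norm_cmult)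
  finally have "cmod c = 1" using L2_norm_eq_0_iff[OF e(1)] e(2) by auto
  with c show thesis by (rule that[rotated])
qed

lemma eigenfunctions_orthogonal:
  assumes g: "g \<in> L2_space M" "AE x in M. g (T x) = \<xi> * g x" and h: "h \<in> L2_space M" "AE x in M. h (T x) = \<eta> * h x"
    and \<xi>\<eta>: "cmod \<xi> = 1" "cmod \<eta> = 1" "\<xi> \<noteq> \<eta>"
  shows "L2_inner M g h = 0"
proof -
  have "L2_inner M g h = L2_inner M (\<lambda>x. g (T x)) (\<lambda>x. h (T x))"
    using L2_inner_funpow[OF g(1) h(1), of 1] by simp
  also have "\<dots> = L2_inner M (\<lambda>x. \<xi> * g x) (\<lambda>x. \<eta> * h x)"
    using g h L2_measurable[OF L2_funpow[OF g(1), of 1]] L2_measurable[OF L2_cmult[OF g(1)]]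
      L2_measurable[OF L2_funpow[OF h(1), of 1]] L2_measurable[OF L2_cmult[OF h(1)]]
    by (intro L2_inner_cong_AE) auto
  also have "\<dots> = \<xi> * cnj \<eta> * L2_inner M g h"
    by (simp add: L2_inner_cmult_left L2_inner_cmult_right)
  finally have "L2_inner M g h = \<xi> * cnj \<eta> * L2_inner M g h" .
  moreover have "\<xi> * cnj \<eta> \<noteq> 1"
  proof
    assume "\<xi> * cnj \<eta> = 1"
    then have "\<xi> * (cnj \<eta> * \<eta>) = \<eta>" by (simp add: mult.assoc[symmetric])
    moreover have "cnj \<eta> * \<eta> = 1"
      using complex_norm_square[of \<eta>] \<xi>\<eta>(2) by (simp add: mult.commute)
    ultimately show False using \<xi>\<eta>(3) by simp
  qed
  ultimately show ?thesis by (metis mult_cancel_right1)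
qed

context
  fixes f :: "'a \<Rightarrow> complex" and C :: real
  assumes f [measurable]: "f \<in> borel_measurable M" and C: "\<And>x. cmod (f x) \<le> C"
begin

private lemma f_L2': "f \<in> L2_space M"
  by (rule L2_bounded[OF f C])

private lemmas part_L2 = eigen_part_L2[OF f C]

lemma eigen_part_orthogonal:
  assumes "cmod \<xi> = 1" "cmod \<eta> = 1" "\<xi> \<noteq> \<eta>"
  shows "L2_inner M (eigen_part \<xi> f) (eigen_part \<eta> f) = 0"
  by (rule eigenfunctions_orthogonal[OF part_L2 eigen_part_eigen part_L2 eigen_part_eigen])
     (use assms f C in auto)

text \<open>
  The sum \<open>s\<close> of the eigenparts over \<open>F\<close> satisfies \<open>\<langle>f, s\<rangle> = \<parallel>s\<parallel>\<^sup>2\<close>, whence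
  \<open>\<parallel>f - s\<parallel>\<^sup>2 = \<parallel>f\<parallel>\<^sup>2 - \<parallel>s\<parallel>\<^sup>2\<close>.
\<close>
lemma eigen_part_Bessel:
  assumes F: "finite F" "F \<subseteq> sphere 0 1"
  shows "(\<Sum>\<xi>\<in>F. (L2_norm M (eigen_part \<xi> f))\<^sup>2) \<le> (L2_norm M f)\<^sup>2"
proof -
  define s where "s = (\<lambda>x. \<Sum>\<xi>\<in>F. eigen_part \<xi> f x)"
  have F1: "cmod \<xi> = 1" if "\<xi> \<in> F" for \<xi> using that F(2) by auto
  have s: "s \<in> L2_space M" unfolding s_def by (intro L2_sum part_L2 F1)
  have ns: "(L2_norm M s)\<^sup>2 = (\<Sum>\<xi>\<in>F. (L2_norm M (eigen_part \<xi> f))\<^sup>2)"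
    unfolding s_def by (intro L2_pythagoras F part_L2 eigen_part_orthogonal F1)
  have "L2_inner M f s = (\<Sum>\<xi>\<in>F. L2_inner M f (eigen_part \<xi> f))"
    unfolding s_def by (intro L2_inner_sum_right part_L2 F1 f_L2')
  also have "\<dots> = (\<Sum>\<xi>\<in>F. of_real ((L2_norm M (eigen_part \<xi> f))\<^sup>2))"
    by (intro sum.cong refl L2_inner_eigen_part_self[OF f C] F1)
  also have "\<dots> = of_real ((L2_norm M s)\<^sup>2)" by (simp add: ns)
  finally have "Re (L2_inner M f s) = (L2_norm M s)\<^sup>2" by simp
  then have "0 \<le> (L2_norm M f)\<^sup>2 - (L2_norm M s)\<^sup>2"
    using L2_norm_diff_sq[OF f_L2' s] zero_le_power2[of "L2_norm M (\<lambda>x. f x - s x)"] by linarith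
  then show ?thesis by (simp add: ns)
qed

lemma eigen_part_summable:
  "(\<lambda>\<xi>. (L2_norm M (eigen_part \<xi> f))\<^sup>2) summable_on sphere 0 1"
proof (rule nonneg_bdd_above_summable_on)
  show "bdd_above (sum (\<lambda>\<xi>. (L2_norm M (eigen_part \<xi> f))\<^sup>2) ` {F. F \<subseteq> sphere 0 1 \<and> finite F})"
    by (rule bdd_aboveI[of _ "(L2_norm M f)\<^sup>2"]) (use eigen_part_Bessel in auto)
qed simp

text \<open>
  The projection of \<open>f\<close> to the Kronecker subspace is the sum of its eigenparts. Finite partial
  sums whose squared norms approach the full sum are Cauchy, since the squared norm of a
  difference is a sum over a symmetric difference, which is small for both index sets.
\<close>
lemma kronecker_norm_has_sum:
  "((\<lambda>\<xi>. (L2_norm M (eigen_part \<xi> f))\<^sup>2) has_sum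
      (L2_norm M (orth_proj M (kronecker_space T M) f))\<^sup>2) (sphere 0 1)"
proof -
  define d where "d \<xi> = (L2_norm M (eigen_part \<xi> f))\<^sup>2" for \<xi>
  have d0: "0 \<le> d \<xi>" for \<xi> by (simp add: d_def)
  define S where "S = {\<xi> \<in> sphere 0 1. d \<xi> \<noteq> 0}"
  have S1: "cmod \<xi> = 1" if "\<xi> \<in> S" for \<xi> using that by (auto simp: S_def)
  have "d summable_on S"
    using eigen_part_summable unfolding d_def S_def by (rule summable_on_subset_banach) auto
  then obtain D where D: "(d has_sum D) S" by (auto simp: summable_on_def)
  have D_sphere: "(d has_sum D) (sphere 0 1)"
    using D by (rule has_sum_cong_neutral[THEN iffD1, rotated -1]) (auto simp: S_def)
  have le_D: "sum d F \<le> D" if "finite F" "F \<subseteq> S" for F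
    using that by (intro finite_sum_le_has_sum[OF D]) (auto simp: d0)
  have "\<exists>F. finite F \<and> F \<subseteq> S \<and> dist (sum d F) D \<le> 1 / real (Suc n)" for n
    using has_sum_finite_approximation[OF D, of "1 / real (Suc n)"] by auto
  then obtain F where F: "\<And>n. finite (F n)" "\<And>n. F n \<subseteq> S" "\<And>n. dist (sum d (F n)) D \<le> 1 / real (Suc n)"
    by metis
  have F_ge: "sum d (F n) \<ge> D - 1 / real (Suc n)" for n
    using F(3)[of n] by (simp add: dist_real_def)
  have rest: "sum d (G - F n) \<le> 1 / real (Suc n)" if "finite G" "G \<subseteq> S" for G n
  proof -
    have "sum d (F n) + sum d (G - F n) = sum d (F n \<union> G)"
      using that F(1) by (subst sum.union_disjoint[symmetric]) auto
    also have "\<dots> \<le> D" using that F(1,2) by (intro le_D) auto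
    finally show ?thesis using F_ge[of n] by simp
  qed
  define s where "s n = (\<lambda>x. \<Sum>\<xi>\<in>F n. eigen_part \<xi> f x)" for n
  have sL2: "s n \<in> L2_space M" for n
    unfolding s_def using F(2) S1 by (intro L2_sum part_L2) blast
  have inv_small: "\<exists>N. \<forall>n\<ge>N. 1 / real (Suc n) < e" if "e > 0" for e
    using order_tendstoD(2)[OF LIMSEQ_inverse_real_of_nat that]
    by (simp add: eventually_sequentially inverse_eq_divide)
  have sum_norm: "(L2_norm M (\<lambda>x. \<Sum>\<xi>\<in>G. a \<xi> * eigen_part \<xi> f x))\<^sup>2 = (\<Sum>\<xi>\<in>G. (cmod (a \<xi>))\<^sup>2 * d \<xi>)"
    if "finite G" "G \<subseteq> S" for a G
  proof -
    have "(L2_norm M (\<lambda>x. \<Sum>\<xi>\<in>G. a \<xi> * eigen_part \<xi> f x))\<^sup>2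
        = (\<Sum>\<xi>\<in>G. (L2_norm M (\<lambda>x. a \<xi> * eigen_part \<xi> f x))\<^sup>2)"
    proof (rule L2_pythagoras[OF that(1)])
      fix \<xi> \<eta> assume "\<xi> \<in> G" "\<eta> \<in> G" "\<xi> \<noteq> \<eta>"
      then show "L2_inner M (\<lambda>x. a \<xi> * eigen_part \<xi> f x) (\<lambda>x. a \<eta> * eigen_part \<eta> f x) = 0"
        using eigen_part_orthogonal[of \<xi> \<eta>] S1 that(2)
        by (auto simp: L2_inner_cmult_left L2_inner_cmult_right)
    qed (use S1 that(2) in \<open>auto intro!: L2_cmult part_L2\<close>)
    then show ?thesis by (simp add: L2_norm_cmult power_mult_distrib d_def)
  qed
  have s_diff: "(L2_norm M (\<lambda>x. s m x - s n x))\<^sup>2 \<le> 1 / real (Suc n) + 1 / real (Suc m)" for m n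
  proof -
    \<comment> \<open>The difference is a combination with coefficients \<open>1\<close> and \<open>-1\<close> on the symmetric difference.\<close>
    define a :: "complex \<Rightarrow> complex" where "a \<xi> = indicator (F m) \<xi> - indicator (F n) \<xi>" for \<xi>
    have "s m x - s n x = (\<Sum>\<xi>\<in>F m \<union> F n. a \<xi> * eigen_part \<xi> f x)" for x
    proof -
      have "s m x = (\<Sum>\<xi>\<in>F m \<union> F n. indicator (F m) \<xi> * eigen_part \<xi> f x)"
        unfolding s_def using F(1) by (intro sum.mono_neutral_cong_left) (auto simp: indicator_def)
      moreover have "s n x = (\<Sum>\<xi>\<in>F m \<union> F n. indicator (F n) \<xi> * eigen_part \<xi> f x)"
        unfolding s_def using F(1) by (intro sum.mono_neutral_cong_left) (auto simp: indicator_def)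
      ultimately show ?thesis by (simp add: a_def left_diff_distrib sum_subtractf)
    qed
    then have "(L2_norm M (\<lambda>x. s m x - s n x))\<^sup>2 = (\<Sum>\<xi>\<in>F m \<union> F n. (cmod (a \<xi>))\<^sup>2 * d \<xi>)"
      using sum_norm[of "F m \<union> F n" a] F(1,2) by simp
    also have "\<dots> = (\<Sum>\<xi>\<in>(F m - F n) \<union> (F n - F m). d \<xi>)"
      using F(1) by (intro sum.mono_neutral_cong_right) (auto simp: a_def indicator_def)
    also have "\<dots> = sum d (F m - F n) + sum d (F n - F m)"
      using F(1) by (intro sum.union_disjoint) auto
    also have "\<dots> \<le> 1 / real (Suc n) + 1 / real (Suc m)"
      using F(1,2) by (intro add_mono rest)
    finally show ?thesis .
  qed
  have "\<exists>N. \<forall>m\<ge>N. \<forall>n\<ge>N. L2_norm M (\<lambda>x. s m x - s n x) < e" if e: "e > 0" for e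
  proof -
    obtain N where N: "\<And>n. n \<ge> N \<Longrightarrow> 1 / real (Suc n) < e\<^sup>2 / 2"
      using inv_small[of "e\<^sup>2 / 2"] e by auto
    have "L2_norm M (\<lambda>x. s m x - s n x) < e" if "m \<ge> N" "n \<ge> N" for m n
    proof (rule power2_less_imp_less)
      show "(L2_norm M (\<lambda>x. s m x - s n x))\<^sup>2 < e\<^sup>2"
        using s_diff[of m n] N[OF that(1)] N[OF that(2)] by linarith
    qed (use e in auto)
    then show ?thesis by blast
  qed
  from L2_complete[OF sL2 this] obtain g where
    g: "g \<in> L2_space M" and lim: "(\<lambda>n. L2_norm M (\<lambda>x. s n x - g x)) \<longlonglongrightarrow> 0"
    by blast
  have norm_g: "(L2_norm M g)\<^sup>2 = D"
  proof (rule LIMSEQ_unique)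
    show "(\<lambda>n. (L2_norm M (s n))\<^sup>2) \<longlonglongrightarrow> (L2_norm M g)\<^sup>2"
      by (intro tendsto_intros L2_norm_tendsto[OF sL2 g lim])
    have "(L2_norm M (s n))\<^sup>2 = sum d (F n)" for n
      using sum_norm[of "F n" "\<lambda>_. 1"] F(1,2) by (simp add: s_def)
    moreover have "(\<lambda>n. sum d (F n)) \<longlonglongrightarrow> D"
    proof (rule LIM_zero_cancel, rule Lim_null_comparison)
      show "\<forall>\<^sub>F n in sequentially. norm (sum d (F n) - D) \<le> 1 / real (Suc n)"
        using F(3) by (simp add: dist_norm)
      show "(\<lambda>n. 1 / real (Suc n)) \<longlonglongrightarrow> 0"
        using LIMSEQ_inverse_real_of_nat by (simp add: inverse_eq_divide)
    qed
    ultimately show "(\<lambda>n. (L2_norm M (s n))\<^sup>2) \<longlonglongrightarrow> D" by simp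
  qed
  let ?E = "eigenfunctions T M"
  have in_E: "eigen_part \<xi> f \<in> ?E" if "\<xi> \<in> S" for \<xi>
  proof -
    have "\<not> (AE x in M. eigen_part \<xi> f x = 0)"
      using that L2_norm_eq_0_iff[OF part_L2[OF S1[OF that]]] by (auto simp: S_def d_def)
    then show ?thesis
      using part_L2[OF S1[OF that]] eigen_part_eigen[OF f C S1[OF that]]
      unfolding eigenfunctions_def koopman_def by auto
  qed
  have inj: "inj_on (\<lambda>\<xi>. eigen_part \<xi> f) S"
  proof (rule inj_onI, rule ccontr)
    fix \<xi> \<eta> assume "\<xi> \<in> S" "\<eta> \<in> S" "eigen_part \<xi> f = eigen_part \<eta> f" "\<xi> \<noteq> \<eta>"
    then have "L2_inner M (eigen_part \<xi> f) (eigen_part \<xi> f) = 0"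
      using eigen_part_orthogonal[of \<xi> \<eta>] S1 by auto
    then show False
      using \<open>\<xi> \<in> S\<close> by (simp add: L2_inner_self S_def d_def)
  qed
  have s_span: "s n \<in> complex_span ?E" for n
    unfolding s_def using F(1,2) in_E inj_on_subset[OF inj F(2)]
    by (intro sum_in_complex_span) auto
  have gK: "g \<in> kronecker_space T M"
    unfolding kronecker_space_def L2_closure_def
  proof (intro CollectI conjI allI impI g)
    fix e :: real assume "e > 0"
    with lim have "\<forall>\<^sub>F n in sequentially. L2_norm M (\<lambda>x. s n x - g x) < e"
      by (rule order_tendstoD)
    then obtain n where "L2_norm M (\<lambda>x. s n x - g x) < e"
      by (auto simp: eventually_sequentially)
    then show "\<exists>h\<in>complex_span ?E. L2_norm M (\<lambda>x. g x - h x) < e"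
      using s_span[of n] L2_norm_minus_commute[of M g "s n"] by (intro bexI[of _ "s n"]) simp_all
  qed
  have orth_E: "L2_inner M (\<lambda>x. f x - g x) e = 0" if e: "e \<in> ?E" for e
  proof -
    have eL2: "e \<in> L2_space M" using e eigenfunctions_subset by auto
    obtain c where c: "cmod c = 1" and eig: "AE x in M. e (T x) = c * e x"
      by (rule eigenfunction_eigenvalue[OF e])
    have part: "L2_inner M (eigen_part c f) e = L2_inner M f e"
      by (rule L2_inner_eigen_part[OF f C c eL2 eig])
    have inner_s: "L2_inner M (s n) e = (if c \<in> F n then L2_inner M f e else 0)" for n
    proof -
      have "L2_inner M (s n) e = (\<Sum>\<xi>\<in>F n. L2_inner M (eigen_part \<xi> f) e)"
        unfolding s_def using F(2)[of n] S1 by (intro L2_inner_sum_left part_L2 eL2) auto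
      also have "\<dots> = (\<Sum>\<xi>\<in>F n. if \<xi> = c then L2_inner M f e else 0)"
      proof (rule sum.cong[OF refl])
        fix \<xi> assume "\<xi> \<in> F n"
        then have \<xi>: "cmod \<xi> = 1" using F(2) S1 by auto
        show "L2_inner M (eigen_part \<xi> f) e = (if \<xi> = c then L2_inner M f e else 0)"
          using part eigenfunctions_orthogonal[OF part_L2[OF \<xi>] eigen_part_eigen[OF f C \<xi>] eL2 eig \<xi> c]
          by auto
      qed
      finally show ?thesis using F(1)[of n] by (simp add: sum.delta)
    qed
    \<comment> \<open>A frequency of positive weight belongs to all late index sets; otherwise \<open>e\<close> is orthogonal to \<open>f\<close>.\<close>
    have "\<forall>\<^sub>F n in sequentially. L2_inner M (s n) e = L2_inner M f e"
    proof (cases "c \<in> S")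
      case True
      then have "d c > 0" using d0[of c] by (auto simp: S_def)
      then obtain N where N: "\<And>n. n \<ge> N \<Longrightarrow> 1 / real (Suc n) < d c" using inv_small by blast
      have "c \<in> F n" if "n \<ge> N" for n
      proof (rule ccontr)
        assume "c \<notin> F n"
        then have "d c \<le> 1 / real (Suc n)" using rest[of "{c}" n] True by (auto simp: insert_Diff_if)
        with N[OF that] show False by simp
      qed
      then show ?thesis unfolding eventually_sequentially inner_s by auto
    next
      case False
      then have "L2_norm M (eigen_part c f) = 0" using c by (simp add: S_def d_def)
      then have "L2_inner M f e = 0"
        using L2_Cauchy_Schwarz[OF part_L2[OF c] eL2] by (simp add: part)
      then show ?thesis unfolding inner_s by simp
    qed
    then have "(\<lambda>n. L2_inner M (s n) e) \<longlonglongrightarrow> L2_inner M f e"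
      by (rule tendsto_eventually)
    moreover have "(\<lambda>n. L2_inner M (s n) e) \<longlonglongrightarrow> L2_inner M g e"
      by (rule L2_inner_tendsto[OF sL2 g eL2 lim])
    ultimately have "L2_inner M f e = L2_inner M g e" by (rule LIMSEQ_unique)
    then show ?thesis by (simp add: L2_inner_diff_left f_L2' g eL2)
  qed
  have orth_span: "L2_inner M (\<lambda>x. f x - g x) h = 0" if "h \<in> complex_span ?E" for h
    by (rule orthogonal_to_span[OF eigenfunctions_subset L2_diff[OF f_L2' g] _ that]) (rule orth_E)
  have orth_K: "L2_inner M (\<lambda>x. f x - g x) h = 0" if "h \<in> kronecker_space T M" for h
    by (rule orthogonal_to_closure[OF complex_span_subset[OF eigenfunctions_subset] L2_diff[OF f_L2' g]
          _ that[unfolded kronecker_space_def]]) (rule orth_span)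
  have "L2_norm M (orth_proj M (kronecker_space T M) f) = L2_norm M g"
    by (rule L2_norm_orth_proj[OF _ f_L2' gK orth_K]) (auto simp: kronecker_space_def L2_closure_def)
  then show ?thesis using D_sphere norm_g by (simp add: d_def[abs_def])
qed

end

end

section \<open>Averages along generic points\<close>

locale compact_system = measure_preserving M T
  for M :: "'a::metric_space measure" and T :: "'a \<Rightarrow> 'a" +
  assumes compact_UNIV: "compact (UNIV :: 'a set)"
    and sets_M [measurable_cong]: "sets M = sets borel"
    and continuous_T: "continuous_on UNIV T"
begin

lemma space_M [simp]: "space M = UNIV"
  using sets_eq_imp_space_eq[OF sets_M] by simp

lemma prob_UNIV [simp]: "prob UNIV = 1"
  using prob_space by simp

lemma continuous_measurable:
  assumes "continuous_on UNIV f"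
  shows "f \<in> borel_measurable M"
  using borel_measurable_continuous_onI[OF assms] measurable_cong_sets[OF sets_M refl] by blast

lemma continuous_bounded:
  fixes f :: "'a \<Rightarrow> complex"
  assumes "continuous_on UNIV f"
  obtains C where "\<And>x. cmod (f x) \<le> C"
proof -
  have "bounded (range f)"
    using compact_imp_bounded[OF compact_continuous_image[OF assms compact_UNIV]] .
  then show thesis using that unfolding bounded_iff by auto
qed

lemma continuous_funpow: "continuous_on UNIV (T ^^ n)"
proof (induction n)
  case (Suc n)
  then show ?case
    using continuous_on_compose[OF Suc continuous_on_subset[OF continuous_T]] by simp
qed (simp add: continuous_on_id id_def)

lemma continuous_FB_avg:
  assumes "continuous_on UNIV f"
  shows "continuous_on UNIV (FB_avg T f \<xi> n)"
proof -
  have "continuous_on UNIV (\<lambda>x. f ((T ^^ j) x))" for j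
    using continuous_on_compose[OF continuous_funpow continuous_on_subset[OF assms]]
    by (simp add: comp_def)
  then show ?thesis unfolding FB_avg_def by (intro continuous_intros)
qed

lemma FB_avg_norm_sq_le:
  assumes \<xi>: "cmod \<xi> = 1"
  shows "(cmod (FB_avg T f \<xi> n x))\<^sup>2 \<le> (\<Sum>j<n. (cmod (f ((T ^^ j) x)))\<^sup>2) / real n"
proof (cases "n = 0")
  case False
  have "cmod (\<Sum>j<n. \<xi> powi (- int j) * f ((T ^^ j) x)) \<le> (\<Sum>j<n. cmod (f ((T ^^ j) x)))"
    by (rule order_trans[OF norm_sum]) (simp add: norm_mult norm_powi_eq_1[OF \<xi>] del: power_int_minus)
  then have "(cmod (\<Sum>j<n. \<xi> powi (- int j) * f ((T ^^ j) x)))\<^sup>2 \<le> (\<Sum>j<n. cmod (f ((T ^^ j) x)))\<^sup>2"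
    by (intro power_mono) auto
  also have "\<dots> \<le> (\<Sum>j<n. (cmod (f ((T ^^ j) x)))\<^sup>2) * real n"
    using sum_squared_le_sum_of_squares[of "\<lambda>j. cmod (f ((T ^^ j) x))" "{..<n}"] by simp
  finally show ?thesis
    using False
    by (simp add: FB_avg_def norm_mult norm_divide power_divide field_simps power2_eq_square del: power_int_minus)
qed (simp add: FB_avg_def)

text \<open>
  Van der Corput's trick: \<open>A\<^sub>n f(x)\<close> is close to the average of \<open>A\<^sub>m f\<close> along the orbit of
  \<open>x\<close>, hence by Cauchy--Schwarz and genericity asymptotically at most \<open>\<parallel>A\<^sub>m f\<parallel>\<close>, for every \<open>m\<close>.
\<close>
lemma generic_FB_avg_bound:
  assumes x: "generic_point T M x" and f: "continuous_on UNIV f" and \<xi>: "cmod \<xi> = 1" and e: "e > 0"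
  shows "\<forall>\<^sub>F n in sequentially. cmod (FB_avg T f \<xi> n x) < L2_norm M (eigen_part \<xi> f) + e"
proof -
  obtain C where C: "\<And>x. cmod (f x) \<le> C" using continuous_bounded[OF f] by blast
  define p where "p = L2_norm M (eigen_part \<xi> f)"
  have p0: "0 \<le> p" by (simp add: p_def L2_norm_nonneg)
  have "\<forall>\<^sub>F m in sequentially. L2_norm M (FB_avg T f \<xi> m) < p + e / 2"
    using L2_norm_FB_avg_lim[OF continuous_measurable[OF f] C \<xi>]
    by (rule order_tendstoD) (use e in \<open>auto simp: p_def\<close>)
  then have "\<forall>\<^sub>F m in sequentially. L2_norm M (FB_avg T f \<xi> m) < p + e / 2 \<and> m > 0"
    using eventually_gt_at_top[of 0] by (rule eventually_conj)
  then obtain m where m: "L2_norm M (FB_avg T f \<xi> m) < p + e / 2" "m > 0"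
    using eventually_happens'[OF sequentially_bot] by blast
  define g where "g = FB_avg T f \<xi> m"
  have "continuous_on UNIV (\<lambda>y. of_real ((cmod (g y))\<^sup>2) :: complex)"
    unfolding g_def by (intro continuous_intros continuous_FB_avg f)
  then have "(\<lambda>n. (1 / of_nat n) * (\<Sum>j<n. of_real ((cmod (g ((T ^^ j) x)))\<^sup>2)) :: complex)
      \<longlonglongrightarrow> (\<integral>y. of_real ((cmod (g y))\<^sup>2) \<partial>M)"
    using x unfolding generic_point_def by blast
  then have "(\<lambda>n. complex_of_real ((\<Sum>j<n. (cmod (g ((T ^^ j) x)))\<^sup>2) / real n))
      \<longlonglongrightarrow> complex_of_real ((L2_norm M g)\<^sup>2)"
    by (simp only: L2_norm_sq integral_complex_of_real) (simp add: mult.commute)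
  then have "(\<lambda>n. (\<Sum>j<n. (cmod (g ((T ^^ j) x)))\<^sup>2) / real n) \<longlonglongrightarrow> (L2_norm M g)\<^sup>2"
    by (simp only: tendsto_of_real_iff)
  moreover have "(L2_norm M g)\<^sup>2 < (p + e / 2)\<^sup>2"
    using m(1) by (intro power_strict_mono) (auto simp: g_def L2_norm_nonneg)
  ultimately have "\<forall>\<^sub>F n in sequentially. (\<Sum>j<n. (cmod (g ((T ^^ j) x)))\<^sup>2) / real n < (p + e / 2)\<^sup>2"
    by (rule order_tendstoD)
  moreover have "\<forall>\<^sub>F n in sequentially. 2 * real m * C / real n < e / 2"
    by (rule order_tendstoD[OF lim_const_over_n]) (use e in simp)
  ultimately have "\<forall>\<^sub>F n in sequentially. cmod (FB_avg T f \<xi> n x) < p + e"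
  proof eventually_elim
    case (elim n)
    have "(cmod (FB_avg T g \<xi> n x))\<^sup>2 < (p + e / 2)\<^sup>2"
      using FB_avg_norm_sq_le[OF \<xi>, of g n x] elim(1) by linarith
    then have "cmod (FB_avg T g \<xi> n x) < p + e / 2"
      by (rule power2_less_imp_less) (use p0 e in auto)
    moreover have "cmod (FB_avg T g \<xi> n x - FB_avg T f \<xi> n x) \<le> 2 * real m * C / real n"
      unfolding g_def by (rule FB_avg_FB_avg[OF \<xi> C m(2)])
    ultimately show ?case
      using elim(2) norm_triangle_sub[of "FB_avg T f \<xi> n x" "FB_avg T g \<xi> n x"]
      by (simp add: norm_minus_commute)
  qed
  then show ?thesis by (simp add: p_def)
qed

lemma FB_generic_lim_le:
  assumes x: "FB_generic T M x" and f: "continuous_on UNIV f" and \<xi>: "cmod \<xi> = 1"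
  shows "cmod (FB_lim T f \<xi> x) \<le> L2_norm M (eigen_part \<xi> f)"
proof (rule field_le_epsilon)
  fix e :: real assume e: "e > 0"
  have "generic_point T M x" "convergent (\<lambda>n. FB_avg T f \<xi> n x)"
    using x f \<xi> unfolding FB_generic_def by auto
  then have "(\<lambda>n. FB_avg T f \<xi> n x) \<longlonglongrightarrow> FB_lim T f \<xi> x"
    unfolding FB_lim_def by (simp add: convergent_LIMSEQ_iff)
  then have "(\<lambda>n. cmod (FB_avg T f \<xi> n x)) \<longlonglongrightarrow> cmod (FB_lim T f \<xi> x)"
    by (rule tendsto_norm)
  then show "cmod (FB_lim T f \<xi> x) \<le> L2_norm M (eigen_part \<xi> f) + e"
  proof (rule tendsto_upperbound)
    show "\<forall>\<^sub>F n in sequentially. cmod (FB_avg T f \<xi> n x) \<le> L2_norm M (eigen_part \<xi> f) + e"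
      using generic_FB_avg_bound[OF \<open>generic_point T M x\<close> f \<xi> e] by eventually_elim simp
  qed simp
qed

lemma generic_point_FB_avg_1:
  assumes "generic_point T M x" "continuous_on UNIV f"
  shows "(\<lambda>n. FB_avg T f 1 n x) \<longlonglongrightarrow> (\<integral>y. f y \<partial>M)"
  using assms unfolding generic_point_def FB_avg_def by simp

section \<open>A Wiener--Wintner generic point forces ergodicity\<close>

text \<open>
  The two sides of the Wiener--Wintner identity sum termwise comparable families over the
  circle, so they agree termwise; at \<open>\<xi> = 1\<close> this says that the invariant part of \<open>f\<close> has
  the norm of its mean.
\<close>
lemma WW_generic_invariant_part:
  assumes x: "WW_generic T M x" and f: "continuous_on UNIV f"
  shows "L2_norm M (eigen_part 1 f) \<le> cmod (\<integral>y. f y \<partial>M)"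
proof -
  obtain C where C: "\<And>x. cmod (f x) \<le> C" using continuous_bounded[OF f] by blast
  have FB: "FB_generic T M x" using x by (simp add: WW_generic_def)
  define r where "r = (L2_norm M (orth_proj M (kronecker_space T M) f))\<^sup>2"
  define d where "d \<xi> = (L2_norm M (eigen_part \<xi> f))\<^sup>2" for \<xi>
  define a where "a \<xi> = (if \<xi> \<in> Freq T x then (cmod (FB_lim T f \<xi> x))\<^sup>2 else 0)" for \<xi>
  have "((\<lambda>\<xi>. (cmod (FB_lim T f \<xi> x))\<^sup>2) has_sum r) (Freq T x)"
    using x f by (simp add: WW_generic_def r_def)
  then have a_sum: "(a has_sum r) (sphere 0 1)"
    by (rule has_sum_cong_neutral[THEN iffD1, rotated -1]) (auto simp: a_def Freq_def)
  have d_sum: "(d has_sum r) (sphere 0 1)"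
    unfolding d_def r_def by (rule kronecker_norm_has_sum[OF continuous_measurable[OF f] C])
  have a_le: "a \<xi> \<le> d \<xi>" if "cmod \<xi> = 1" for \<xi>
    using FB_generic_lim_le[OF FB f that] by (auto simp: a_def d_def intro: power_mono)
  have "((\<lambda>\<xi>. - a \<xi>) has_sum - r) (sphere 0 1)"
    using a_sum by (simp add: has_sum_uminus)
  from has_sum_add[OF d_sum this] have "d 1 + - a 1 = 0"
    by (rule nonneg_has_sum_le_0D) (use a_le in auto)
  moreover have "FB_lim T f 1 x = (\<integral>y. f y \<partial>M)"
    unfolding FB_lim_def using FB f by (intro limI generic_point_FB_avg_1) (auto simp: FB_generic_def)
  ultimately have "(L2_norm M (eigen_part 1 f))\<^sup>2 \<le> (cmod (\<integral>y. f y \<partial>M))\<^sup>2"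
    by (auto simp: d_def a_def split: if_splits)
  then show ?thesis by (rule power2_le_imp_le) simp
qed

text \<open>
  By Pythagoras and the bound on its norm, the invariant part of \<open>f\<close> equals the mean of \<open>f\<close>
  almost everywhere; it has the same inner product with the indicator of \<open>B\<close> as \<open>f\<close>.
\<close>
lemma integral_invariant_set:
  assumes f: "continuous_on UNIV f" and B: "B \<in> sets M" "T -` B = B"
    and le: "L2_norm M (eigen_part 1 f) \<le> cmod (\<integral>y. f y \<partial>M)"
  shows "(\<integral>y. f y * indicator B y \<partial>M) = (\<integral>y. f y \<partial>M) * measure M B"
proof -
  obtain C where C: "\<And>x. cmod (f x) \<le> C" using continuous_bounded[OF f] by blast
  note fm = continuous_measurable[OF f]
  define h where "h = eigen_part 1 f"
  define c where "c = (\<integral>y. f y \<partial>M)"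
  have h: "h \<in> L2_space M" unfolding h_def by (rule eigen_part_L2[OF fm C]) simp
  have const: "(\<lambda>y. k) \<in> L2_space M" for k :: complex by (rule L2_bounded[of _ "cmod k"]) auto
  have ind: "(indicator B :: 'a \<Rightarrow> complex) \<in> L2_space M"
    by (rule L2_bounded[of _ 1]) (use B in \<open>auto simp: indicator_def\<close>)
  have inner: "L2_inner M h e = L2_inner M f e" if "e \<in> L2_space M" "\<And>y. e (T y) = e y" for e
    unfolding h_def by (rule L2_inner_eigen_part[OF fm C]) (use that in auto)
  have "L2_inner M h (\<lambda>y. c) = L2_inner M f (\<lambda>y. c)" by (rule inner[OF const]) simp
  also have "\<dots> = c * cnj c" by (simp add: L2_inner_def c_def)
  also have "\<dots> = of_real ((cmod c)\<^sup>2)" by (simp add: complex_norm_square del: of_real_power)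
  finally have "Re (L2_inner M h (\<lambda>y. c)) = (cmod c)\<^sup>2" by simp
  moreover have "(L2_norm M (\<lambda>y. c))\<^sup>2 = (cmod c)\<^sup>2" by (simp add: L2_norm_sq prob_space)
  moreover have "(L2_norm M h)\<^sup>2 \<le> (cmod c)\<^sup>2"
    using le by (intro power_mono) (auto simp: h_def c_def L2_norm_nonneg)
  ultimately have "(L2_norm M (\<lambda>y. h y - c))\<^sup>2 \<le> 0"
    using L2_norm_diff_sq[OF h const[of c]] by simp
  then have "AE y in M. h y = c"
    using L2_norm_eq_0_iff[OF L2_diff[OF h const[of c]]] by simp
  then have "L2_inner M h (indicator B) = L2_inner M (\<lambda>y. c) (indicator B)"
    using L2_measurable[OF h] L2_measurable[OF ind] by (intro L2_inner_cong_AE) auto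
  also have "\<dots> = c * measure M B"
  proof -
    have "L2_inner M (\<lambda>y. c) (indicator B) = (\<integral>y. indicator B y *\<^sub>R c \<partial>M)"
      unfolding L2_inner_def by (intro Bochner_Integration.integral_cong) (auto simp: indicator_def)
    also have "\<dots> = measure M B *\<^sub>R c"
      using B(1) by (subst integral_scaleR_left) (auto intro: integrable_const_bound[of _ 1])
    finally show ?thesis by (simp add: scaleR_conv_of_real mult.commute)
  qed
  finally have "L2_inner M f (indicator B) = c * measure M B"
  proof (subst inner[OF ind, symmetric])
    show "indicator B (T y) = (indicator B y :: complex)" for y
      using B(2) by (metis indicator_simps vimage_eq)
  qed
  moreover have "L2_inner M f (indicator B) = (\<integral>y. f y * indicator B y \<partial>M)"
    unfolding L2_inner_def by (intro Bochner_Integration.integral_cong) (auto simp: indicator_def)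
  ultimately show ?thesis by (simp add: c_def)
qed

lemma indicator_closed_limit:
  assumes "closed (F :: 'a set)"
  obtains g :: "nat \<Rightarrow> 'a \<Rightarrow> real" where "\<And>n. continuous_on UNIV (g n)" "\<And>n y. 0 \<le> g n y \<and> g n y \<le> 1"
    "\<And>y. (\<lambda>n. g n y) \<longlonglongrightarrow> indicator F y"
proof (cases "F = {}")
  case True
  show thesis by (rule that[of "\<lambda>_ _. 0"]) (auto simp: True)
next
  case False
  define g where "g n y = max 0 (1 - real n * infdist y F)" for n y
  show thesis
  proof
    show "continuous_on UNIV (g n)" for n
      unfolding g_def by (intro continuous_intros)
    show "0 \<le> g n y \<and> g n y \<le> 1" for n y
      by (simp add: g_def infdist_nonneg)
    show "(\<lambda>n. g n y) \<longlonglongrightarrow> indicator F y" for y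
    proof (cases "y \<in> F")
      case True
      then show ?thesis by (simp add: g_def)
    next
      case outside: False
      then have pos: "infdist y F > 0" using infdist_pos_not_in_closed[OF assms False] by simp
      have "\<forall>\<^sub>F n in sequentially. real n \<ge> 1 / infdist y F"
        using eventually_ge_at_top[of "nat \<lceil>1 / infdist y F\<rceil>"]
        by eventually_elim linarith
      then have "\<forall>\<^sub>F n in sequentially. g n y = indicator F y"
        by eventually_elim (use pos outside in \<open>auto simp: g_def field_simps\<close>)
      then show ?thesis by (rule tendsto_eventually)
    qed
  qed
qed

text \<open>
  Closed sets generate the Borel sets and their indicators are limits of continuous functions,
  so \<open>B\<close> is independent of every Borel set, in particular of itself.
\<close>
lemma ergodic_if_integral_invariant_set:
  assumes "\<And>B f. B \<in> sets M \<Longrightarrow> T -` B = B \<Longrightarrow> continuous_on UNIV f \<Longrightarrow>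
     (\<integral>y. (f y :: complex) * indicator B y \<partial>M) = (\<integral>y. f y \<partial>M) * measure M B"
  shows "ergodic T M"
  unfolding ergodic_def
proof (intro ballI impI)
  fix B assume B': "B \<in> sets borel" and inv: "T -` B = B"
  then have B [measurable]: "B \<in> sets M" by (simp add: sets_M)
  have closed: "measure M (F \<inter> B) = measure M F * measure M B" if F: "closed F" for F
  proof -
    have Fm [measurable]: "F \<in> sets M" using F by (simp add: sets_M)
    obtain g :: "nat \<Rightarrow> 'a \<Rightarrow> real" where g: "\<And>n. continuous_on UNIV (g n)" "\<And>n y. 0 \<le> g n y \<and> g n y \<le> 1"
      "\<And>y. (\<lambda>n. g n y) \<longlonglongrightarrow> indicator F y"
      using indicator_closed_limit[OF F] by blast
    have [measurable]: "g n \<in> borel_measurable M" for n by (rule continuous_measurable[OF g(1)])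
    have "(\<integral>y. g n y * indicator B y \<partial>M) = (\<integral>y. g n y \<partial>M) * measure M B" for n
    proof -
      have "complex_of_real (\<integral>y. g n y * indicator B y \<partial>M)
          = (\<integral>y. complex_of_real (g n y * indicator B y) \<partial>M)"
        by (rule integral_complex_of_real[symmetric])
      also have "\<dots> = (\<integral>y. complex_of_real (g n y) * indicator B y \<partial>M)"
        by (intro Bochner_Integration.integral_cong) (auto simp: indicator_def)
      also have "\<dots> = (\<integral>y. complex_of_real (g n y) \<partial>M) * measure M B"
        by (intro assms B inv continuous_intros g)
      also have "\<dots> = complex_of_real ((\<integral>y. g n y \<partial>M) * measure M B)"
        by (simp only: integral_complex_of_real of_real_mult)
      finally have "complex_of_real (\<integral>y. g n y * indicator B y \<partial>M)
          = complex_of_real ((\<integral>y. g n y \<partial>M) * measure M B)" .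
      then show ?thesis by (simp only: of_real_eq_iff)
    qed
    moreover have "(\<lambda>n. \<integral>y. g n y * indicator B y \<partial>M) \<longlonglongrightarrow> (\<integral>y. indicator F y * indicator B y \<partial>M)"
      by (rule integral_dominated_convergence[where w = "\<lambda>_. 1"])
         (use g in \<open>auto intro!: tendsto_intros simp: indicator_def\<close>)
    moreover have "(\<lambda>n. (\<integral>y. g n y \<partial>M) * measure M B) \<longlonglongrightarrow> (\<integral>y. indicator F y \<partial>M) * measure M B"
      by (intro tendsto_intros integral_dominated_convergence[where w = "\<lambda>_. 1"])
         (use g in auto)
    ultimately have "(\<integral>y. indicator F y * indicator B y \<partial>M) = (\<integral>y. indicator F y \<partial>M) * measure M B"
      using LIMSEQ_unique by simp
    then show ?thesis by (simp flip: indicator_inter_arith)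
  qed
  have "measure M (A \<inter> B) = measure M A * measure M B" if "A \<in> sets borel" for A
  proof -
    have "Int_stable (Collect closed :: 'a set set)" "Collect closed \<subseteq> Pow (UNIV :: 'a set)"
      "A \<in> sigma_sets UNIV (Collect closed)"
      using that by (auto simp: Int_stable_def borel_eq_closed)
    then show ?thesis
    proof (induction rule: sigma_sets_induct_disjoint)
      case (compl A)
      then have A: "A \<in> sets M" by (simp add: sets_M borel_eq_closed)
      have inter: "measure M ((UNIV - A) \<inter> B) = measure M B - measure M (A \<inter> B)"
        using A finite_measure_Diff'[of B A] by (simp add: Int_commute[of A] Diff_eq[symmetric] Int_commute[of "- A"] Compl_eq_Diff_UNIV[symmetric])
      have whole: "measure M (UNIV - A) = 1 - measure M A" using A prob_compl[of A] by simp
      show ?case unfolding inter whole using compl(2) by (simp add: algebra_simps)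
    next
      case (union A)
      then have A: "range A \<subseteq> sets M" by (auto simp: sets_M borel_eq_closed)
      have "(\<lambda>i. measure M (A i \<inter> B)) sums measure M (\<Union>i. A i \<inter> B)"
        using A union(1) by (intro finite_measure_UNION) (auto simp: disjoint_family_on_def)
      moreover have "(\<lambda>i. measure M (A i) * measure M B) sums (measure M (\<Union>i. A i) * measure M B)"
        using A union(1) by (intro sums_mult2 finite_measure_UNION) auto
      ultimately show ?case using union(3) sums_unique2 by (simp add: UN_simps)
    qed (auto simp: closed)
  qed
  from this[OF B'] show "measure M B = 0 \<or> measure M B = 1" by simp
qed

lemma WW_generic_imp_ergodic:
  assumes "WW_generic T M x"
  shows "ergodic T M"
  by (intro ergodic_if_integral_invariant_set integral_invariant_set WW_generic_invariant_part[OF assms])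

end

section \<open>The pointwise ergodic theorem for ergodic measures\<close>

context measure_preserving
begin

text \<open>
  Garsia's argument: the running maximum \<open>m\<^sub>n\<close> of the partial sums satisfies
  \<open>m\<^sub>n\<^sub>+\<^sub>1 = max 0 (g + m\<^sub>n \<circ> T)\<close>, hence \<open>g \<ge> m\<^sub>n - m\<^sub>n \<circ> T\<close> where \<open>m\<^sub>n > 0\<close>, and the right-hand
  side has integral \<open>0\<close>.
\<close>
lemma maximal_ergodic:
  fixes g :: "'a \<Rightarrow> real"
  assumes g [measurable]: "g \<in> borel_measurable M" and C: "\<And>x. \<bar>g x\<bar> \<le> C"
    and pos: "AE x in M. \<exists>n. (\<Sum>j<n. g ((T ^^ j) x)) > 0"
  shows "0 \<le> (\<integral>x. g x \<partial>M)"
proof -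
  define m where "m = rec_nat (\<lambda>x. 0) (\<lambda>n u x. max 0 (g x + u (T x)))"
  have m0: "m 0 = (\<lambda>x. 0)" and mSuc: "m (Suc n) = (\<lambda>x. max 0 (g x + m n (T x)))" for n
    by (simp_all add: m_def)
  have [measurable]: "m n \<in> borel_measurable M" for n
    by (induction n) (simp_all add: m0 mSuc)
  have m_nonneg: "0 \<le> m n x" for n x by (cases n) (simp_all add: m0 mSuc)
  have m_mono: "m n x \<le> m (Suc n) x" for n x
  proof (induction n arbitrary: x)
    case (Suc n)
    from Suc[of "T x"] show ?case by (simp add: mSuc max.coboundedI2 le_max_iff_disj) linarith
  qed (simp add: m0 mSuc)
  have m_bound: "m n x \<le> real n * C" for n x
  proof (induction n arbitrary: x)
    case (Suc n)
    have "0 \<le> C" using C[of x] by linarith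
    then show ?case using Suc[of "T x"] C[of x] by (simp add: mSuc algebra_simps)
  qed (simp add: m0)
  have m_integrable: "integrable M (m n)" for n
    by (rule integrable_const_bound[of _ "real n * C"]) (auto simp: m_nonneg m_bound)
  have S_le: "(\<Sum>j<n. g ((T ^^ j) x)) \<le> m n x" for n x
  proof (induction n arbitrary: x)
    case (Suc n)
    have "(\<Sum>j<Suc n. g ((T ^^ j) x)) = g x + (\<Sum>j<n. g ((T ^^ j) (T x)))"
      by (subst sum.lessThan_Suc_shift) (simp add: funpow_swap1)
    then show ?case using Suc[of "T x"] by (simp add: mSuc)
  qed (simp add: m0)
  define A where "A n = {x. 0 < m n x}" for n
  have ind_m: "(\<lambda>x. indicator (A n) x :: real) = (\<lambda>x. if 0 < m n x then 1 else 0)" for n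
    by (auto simp: A_def indicator_def)
  have [measurable]: "(\<lambda>x. indicator (A n) x :: real) \<in> borel_measurable M" for n
    unfolding ind_m by measurable
  have ge: "0 \<le> (\<integral>x. g x * indicator (A n) x \<partial>M)" for n
  proof -
    have "m n x - m n (T x) \<le> g x * indicator (A n) x" for x
    proof (cases "x \<in> A n")
      case True
      then obtain k where k: "n = Suc k" by (cases n) (auto simp: A_def m0)
      have "m n x = g x + m k (T x)" using True by (simp add: A_def k mSuc max_def split: if_splits)
      then show ?thesis using True m_mono[of k "T x"] by (simp add: k)
    next
      case False
      then have "m n x = 0" using m_nonneg[of n x] by (simp add: A_def)
      then show ?thesis using False m_nonneg[of n "T x"] by simp
    qed
    moreover have "integrable M (\<lambda>x. m n (T x))" using integrable_funpow[OF m_integrable, of n 1] by simp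
    moreover have "integrable M (\<lambda>x. g x * indicator (A n) x)"
    proof (rule integrable_const_bound)
      show "AE x in M. norm (g x * indicator (A n) x) \<le> C"
        using C by (auto simp: indicator_def intro: order_trans[OF abs_ge_zero])
    qed measurable
    ultimately have "(\<integral>x. m n x - m n (T x) \<partial>M) \<le> (\<integral>x. g x * indicator (A n) x \<partial>M)"
      by (intro integral_mono) (auto simp: m_integrable)
    also have "(\<integral>x. m n x - m n (T x) \<partial>M) = 0"
      using integrable_funpow[OF m_integrable, of n 1] integral_funpow[of "m n" 1] by (simp add: m_integrable)
    finally show ?thesis .
  qed
  have "(\<lambda>n. \<integral>x. g x * indicator (A n) x \<partial>M) \<longlonglongrightarrow> (\<integral>x. g x \<partial>M)"
  proof (rule integral_dominated_convergence[where w = "\<lambda>_. C"])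
    show "AE x in M. (\<lambda>n. g x * indicator (A n) x) \<longlonglongrightarrow> g x"
      using pos
    proof eventually_elim
      case (elim x)
      then obtain k where "m k x > 0" using S_le[of x] less_le_trans by blast
      then have "m n x > 0" if "n \<ge> k" for n
        using lift_Suc_mono_le[of "\<lambda>n. m n x", OF m_mono that] by linarith
      then have "\<forall>\<^sub>F n in sequentially. g x * indicator (A n) x = g x"
        unfolding eventually_sequentially A_def by (intro exI[of _ k]) auto
      then show ?case by (rule tendsto_eventually)
    qed
    show "AE x in M. norm (g x * indicator (A n) x) \<le> C" for n
      using C by (auto simp: indicator_def intro: order_trans[OF abs_ge_zero])
  qed auto
  then show ?thesis using ge by (intro LIMSEQ_le_const) auto
qed

end

context compact_system
begin

text \<open>
  The set where the partial sums of \<open>\<phi> - c\<close> are unbounded above is strictly invariant, because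
  passing from \<open>x\<close> to \<open>T x\<close> changes these sums by a bounded amount. It cannot have full measure
  when \<open>c\<close> exceeds the mean, by the maximal ergodic lemma.
\<close>
lemma ergodic_sums_bounded_above:
  fixes \<phi> :: "'a \<Rightarrow> real"
  assumes erg: "ergodic T M" and \<phi> [measurable]: "\<phi> \<in> borel_measurable M" and C: "\<And>x. \<bar>\<phi> x\<bar> \<le> C"
    and c: "(\<integral>x. \<phi> x \<partial>M) < c"
  shows "AE x in M. \<exists>K::nat. \<forall>n. (\<Sum>j<n. \<phi> ((T ^^ j) x)) \<le> real n * c + real K"
proof -
  define g where "g x = \<phi> x - c" for x
  have [measurable]: "g \<in> borel_measurable M" unfolding g_def by measurable
  define S where "S n x = (\<Sum>j<n. g ((T ^^ j) x))" for n x
  have S_eq: "S n x = (\<Sum>j<n. \<phi> ((T ^^ j) x)) - real n * c" for n x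
    by (simp add: S_def g_def sum_subtractf)
  have g_bound: "\<bar>g x\<bar> \<le> C + \<bar>c\<bar>" for x using C[of x] by (simp add: g_def)
  have S_Suc: "S (Suc n) x = g x + S n (T x)" for n x
    unfolding S_def by (subst sum.lessThan_Suc_shift) (simp add: funpow_swap1)
  have [measurable]: "S n \<in> borel_measurable M" for n unfolding S_def by measurable
  define E where "E = {x. \<forall>K::nat. \<exists>n. S n x > real K}"
  have "{x \<in> space M. \<forall>K::nat. \<exists>n. S n x > real K} \<in> sets M" by measurable
  then have E [measurable]: "E \<in> sets M" by (simp add: E_def)
  have "T -` E = E"
  proof (intro equalityI subsetI)
    fix x assume x: "x \<in> T -` E"
    have "\<exists>n. S n x > real K" for K :: nat
    proof -
      obtain K' :: nat where K': "real K' \<ge> real K + (C + \<bar>c\<bar>)" using real_arch_simple by blast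
      obtain n where "S n (T x) > real K'" using x by (auto simp: E_def)
      then have "S (Suc n) x > real K" using S_Suc[of n x] g_bound[of x] K' by linarith
      then show ?thesis by blast
    qed
    then show "x \<in> E" by (simp add: E_def)
  next
    fix x assume x: "x \<in> E"
    have "\<exists>n. S n (T x) > real K" for K :: nat
    proof -
      obtain K' :: nat where K': "real K' \<ge> real K + (C + \<bar>c\<bar>)" using real_arch_simple by blast
      obtain n where n: "S n x > real K'" using x by (auto simp: E_def)
      obtain k where k: "n = Suc k" using n by (cases n) (auto simp: S_def)
      have "S k (T x) > real K" using n[unfolded k] S_Suc[of k x] g_bound[of x] K' by linarith
      then show ?thesis by blast
    qed
    then show "x \<in> T -` E" by (simp add: E_def)
  qed
  then have "prob E = 0 \<or> prob E = 1" using erg E by (simp add: ergodic_def sets_M)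
  moreover have "prob E \<noteq> 1"
  proof
    assume "prob E = 1"
    then have "AE x in M. x \<in> E" by (simp add: AE_in_set_eq_1 E)
    then have "AE x in M. \<exists>n. (\<Sum>j<n. g ((T ^^ j) x)) > 0"
    proof eventually_elim
      case (elim x)
      then have "\<exists>n. S n x > real 0" unfolding E_def by blast
      then show ?case by (simp add: S_def)
    qed
    then have "0 \<le> (\<integral>x. g x \<partial>M)" by (intro maximal_ergodic[OF _ g_bound]) auto
    moreover have "integrable M \<phi>" by (rule integrable_const_bound[of _ C]) (use C in auto)
    ultimately show False using c by (simp add: g_def prob_space)
  qed
  ultimately have "prob E = 0" by blast
  then have "AE x in M. x \<notin> E" using E by (simp add: prob_eq_0)
  then show ?thesis
  proof eventually_elim
    case (elim x)
    then obtain K :: nat where "\<And>n. S n x \<le> real K" by (auto simp: E_def not_less)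
    then have "(\<Sum>j<n. \<phi> ((T ^^ j) x)) \<le> real n * c + real K" for n
      using S_eq[of n x] by (metis add.commute diff_le_eq)
    then show ?case by blast
  qed
qed

lemma birkhoff_ergodic_upper:
  fixes \<phi> :: "'a \<Rightarrow> real"
  assumes erg: "ergodic T M" and \<phi>: "\<phi> \<in> borel_measurable M" and C: "\<And>x. \<bar>\<phi> x\<bar> \<le> C"
  shows "AE x in M. \<forall>e>0. \<forall>\<^sub>F n in sequentially. (\<Sum>j<n. \<phi> ((T ^^ j) x)) / real n < (\<integral>x. \<phi> x \<partial>M) + e"
proof -
  have "AE x in M. \<forall>i::nat. \<exists>K::nat. \<forall>n.
      (\<Sum>j<n. \<phi> ((T ^^ j) x)) \<le> real n * ((\<integral>x. \<phi> x \<partial>M) + 1 / real (Suc i)) + real K"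
    unfolding AE_all_countable
    by (intro allI ergodic_sums_bounded_above[OF erg \<phi> C]) simp
  then show ?thesis
  proof eventually_elim
    case (elim x)
    show ?case
    proof (intro allI impI)
      fix e :: real assume "e > 0"
      then obtain i where i: "1 / real (Suc i) < e / 2"
        using nat_approx_posE[of "e / 2"] by auto
      obtain K :: nat where K: "\<And>n. (\<Sum>j<n. \<phi> ((T ^^ j) x))
          \<le> real n * ((\<integral>x. \<phi> x \<partial>M) + 1 / real (Suc i)) + real K"
        using elim by blast
      have "\<forall>\<^sub>F n in sequentially. real K / real n < e / 2"
        by (rule order_tendstoD[OF lim_const_over_n]) (use \<open>e > 0\<close> in simp)
      then show "\<forall>\<^sub>F n in sequentially. (\<Sum>j<n. \<phi> ((T ^^ j) x)) / real n < (\<integral>x. \<phi> x \<partial>M) + e"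
        using eventually_gt_at_top[of 0]
      proof eventually_elim
        case (elim n)
        have "(\<Sum>j<n. \<phi> ((T ^^ j) x)) / real n
            \<le> (real n * ((\<integral>x. \<phi> x \<partial>M) + 1 / real (Suc i)) + real K) / real n"
          by (intro divide_right_mono K) simp
        also have "\<dots> = (\<integral>x. \<phi> x \<partial>M) + 1 / real (Suc i) + real K / real n"
          using elim(2) by (simp add: add_divide_distrib)
        finally show ?case using elim(1) i by linarith
      qed
    qed
  qed
qed

lemma birkhoff_ergodic_real:
  fixes \<phi> :: "'a \<Rightarrow> real"
  assumes erg: "ergodic T M" and \<phi>: "\<phi> \<in> borel_measurable M" and C: "\<And>x. \<bar>\<phi> x\<bar> \<le> C"
  shows "AE x in M. (\<lambda>n. (\<Sum>j<n. \<phi> ((T ^^ j) x)) / real n) \<longlonglongrightarrow> (\<integral>x. \<phi> x \<partial>M)"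
proof -
  have "AE x in M. \<forall>e>0. \<forall>\<^sub>F n in sequentially.
      (\<Sum>j<n. - \<phi> ((T ^^ j) x)) / real n < (\<integral>x. - \<phi> x \<partial>M) + e"
    using \<phi> C by (intro birkhoff_ergodic_upper[OF erg, where C = C]) auto
  with birkhoff_ergodic_upper[OF erg \<phi> C] show ?thesis
  proof eventually_elim
    case (elim x)
    show ?case
    proof (rule order_tendstoI)
      fix u assume "(\<integral>x. \<phi> x \<partial>M) < u"
      then have "u - (\<integral>x. \<phi> x \<partial>M) > 0" by simp
      with elim(1) show "\<forall>\<^sub>F n in sequentially. (\<Sum>j<n. \<phi> ((T ^^ j) x)) / real n < u"
        by (auto dest: spec[of _ "u - (\<integral>x. \<phi> x \<partial>M)"])
    next
      fix l assume "l < (\<integral>x. \<phi> x \<partial>M)"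
      then have "(\<integral>x. \<phi> x \<partial>M) - l > 0" by simp
      with elim(2) have "\<forall>\<^sub>F n in sequentially.
          (\<Sum>j<n. - \<phi> ((T ^^ j) x)) / real n < (\<integral>x. - \<phi> x \<partial>M) + ((\<integral>x. \<phi> x \<partial>M) - l)"
        by blast
      then show "\<forall>\<^sub>F n in sequentially. l < (\<Sum>j<n. \<phi> ((T ^^ j) x)) / real n"
        by eventually_elim (simp add: sum_negf)
    qed
  qed
qed

lemma birkhoff_ergodic:
  fixes f :: "'a \<Rightarrow> complex"
  assumes erg: "ergodic T M" and f [measurable]: "f \<in> borel_measurable M" and C: "\<And>x. cmod (f x) \<le> C"
  shows "AE x in M. (\<lambda>n. FB_avg T f 1 n x) \<longlonglongrightarrow> (\<integral>y. f y \<partial>M)"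
proof -
  have int: "integrable M f" by (rule integrable_const_bound[of _ C]) (use C in auto)
  have "AE x in M. (\<lambda>n. (\<Sum>j<n. Re (f ((T ^^ j) x))) / real n) \<longlonglongrightarrow> (\<integral>y. Re (f y) \<partial>M)"
    by (rule birkhoff_ergodic_real[OF erg, of _ C]) (auto intro: order_trans[OF abs_Re_le_cmod C])
  moreover have "AE x in M. (\<lambda>n. (\<Sum>j<n. Im (f ((T ^^ j) x))) / real n) \<longlonglongrightarrow> (\<integral>y. Im (f y) \<partial>M)"
    by (rule birkhoff_ergodic_real[OF erg, of _ C]) (auto intro: order_trans[OF abs_Im_le_cmod C])
  ultimately show ?thesis
  proof eventually_elim
    case (elim x)
    then show ?case
      unfolding tendsto_complex_iff FB_avg_def by (simp add: int Re_divide_of_nat Im_divide_of_nat)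
  qed
qed

end

section \<open>Twisted averages for ergodic measures\<close>

context compact_system
begin

text \<open>
  The Birkhoff averages of an invariant function are the function itself.
\<close>
lemma ergodic_invariant_function_AE_const:
  fixes f :: "'a \<Rightarrow> complex"
  assumes erg: "ergodic T M" and f: "f \<in> borel_measurable M" and C: "\<And>x. cmod (f x) \<le> C"
    and inv: "AE x in M. f (T x) = f x"
  shows "AE x in M. f x = (\<integral>y. f y \<partial>M)"
proof -
  have "AE x in M. \<forall>j. f ((T ^^ Suc j) x) = f ((T ^^ j) x)"
    unfolding AE_all_countable using AE_funpow[OF inv] by simp
  with birkhoff_ergodic[OF erg f C] show ?thesis
  proof eventually_elim
    case (elim x)
    have "f ((T ^^ j) x) = f x" for j
      using elim(2) by (induction j) auto
    then have "FB_avg T f 1 n x = f x" if "n > 0" for n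
      using that by (simp add: FB_avg_def)
    then have "\<forall>\<^sub>F n in sequentially. FB_avg T f 1 n x = f x"
      using eventually_gt_at_top[of 0] by (rule eventually_mono[rotated])
    then have "(\<lambda>n. FB_avg T f 1 n x) \<longlonglongrightarrow> f x" by (rule tendsto_eventually)
    with elim(1) show ?case using LIMSEQ_unique by blast
  qed
qed

text \<open>
  The phase of an eigenfunction is again one, and by ergodicity its modulus, an invariant
  function with values \<open>0\<close> and \<open>1\<close>, is constantly \<open>1\<close>.
\<close>
lemma ergodic_unimodular_eigenfunction:
  assumes erg: "ergodic T M" and h: "h \<in> L2_space M" and eig: "AE x in M. h (T x) = \<xi> * h x"
    and \<xi>: "cmod \<xi> = 1" and nz: "L2_norm M h \<noteq> 0"
  obtains e where "e \<in> borel_measurable M" "\<And>x. cmod (e x) \<le> 1"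
    "AE x in M. cmod (e x) = 1" "AE x in M. e (T x) = \<xi> * e x"
proof -
  define e where "e x = h x / of_real (cmod (h x))" for x
  have [measurable]: "h \<in> borel_measurable M" by (rule L2_measurable[OF h])
  have e [measurable]: "e \<in> borel_measurable M" unfolding e_def by measurable
  have cmod_e: "cmod (e x) = (if h x = 0 then 0 else 1)" for x by (simp add: e_def norm_divide)
  have eT: "AE x in M. e (T x) = \<xi> * e x"
    using eig by eventually_elim (simp add: e_def norm_mult \<xi>)
  define \<phi> where "\<phi> x = complex_of_real (cmod (e x))" for x
  have \<phi> [measurable]: "\<phi> \<in> borel_measurable M" unfolding \<phi>_def by measurable
  have "AE x in M. \<phi> (T x) = \<phi> x"
    using eT by eventually_elim (simp add: \<phi>_def norm_mult \<xi>)
  then have const: "AE x in M. \<phi> x = (\<integral>y. \<phi> y \<partial>M)"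
    by (intro ergodic_invariant_function_AE_const[OF erg \<phi>, of 1]) (auto simp: \<phi>_def cmod_e)
  have "\<not> (AE x in M. h x = 0)" using L2_norm_eq_0_iff[OF h] nz by simp
  have "(\<integral>y. \<phi> y \<partial>M) \<noteq> 0"
  proof
    assume "(\<integral>y. \<phi> y \<partial>M) = 0"
    with const have "AE x in M. \<phi> x = 0" by simp
    then have "AE x in M. h x = 0" by eventually_elim (simp add: \<phi>_def cmod_e split: if_splits)
    with \<open>\<not> (AE x in M. h x = 0)\<close> show False by blast
  qed
  with const have "AE x in M. cmod (e x) = 1"
    by (auto elim!: eventually_mono simp: \<phi>_def cmod_e split: if_splits)
  then show thesis using that[OF e _ _ eT] by (simp add: cmod_e)
qed

text \<open>
  If \<open>\<xi>\<close> is an eigenvalue with unimodular eigenfunction \<open>e\<close>, then \<open>\<xi>\<^sup>-\<^sup>j f(T\<^sup>j x)\<close> equals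
  \<open>e(x)\<close> times \<open>f \<cdot> cnj e\<close> at \<open>T\<^sup>j x\<close>, so the twisted averages are ordinary ones.
\<close>
lemma ergodic_FB_avg_converges:
  assumes erg: "ergodic T M" and f [measurable]: "f \<in> borel_measurable M" and C: "\<And>x. cmod (f x) \<le> C"
    and \<xi>: "cmod \<xi> = 1" and nz: "L2_norm M (eigen_part \<xi> f) \<noteq> 0"
  shows "AE x in M. convergent (\<lambda>n. FB_avg T f \<xi> n x) \<and>
     (\<lambda>n. cmod (FB_avg T f \<xi> n x)) \<longlonglongrightarrow> L2_norm M (eigen_part \<xi> f)"
proof -
  obtain e where e [measurable]: "e \<in> borel_measurable M" and e1: "\<And>x. cmod (e x) \<le> 1"
    and e2: "AE x in M. cmod (e x) = 1" and eT: "AE x in M. e (T x) = \<xi> * e x"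
    using ergodic_unimodular_eigenfunction[OF erg eigen_part_L2[OF f C \<xi>] eigen_part_eigen[OF f C \<xi>] \<xi> nz]
    by blast
  define F where "F x = f x * cnj (e x)" for x
  have F [measurable]: "F \<in> borel_measurable M" unfolding F_def by measurable
  have FC: "cmod (F x) \<le> C" for x
  proof -
    have "cmod (f x) * cmod (e x) \<le> C * 1"
      using C[of x] e1[of x] by (intro mult_mono) (auto intro: order_trans[OF norm_ge_zero])
    then show ?thesis by (simp add: F_def norm_mult)
  qed
  define c where "c = (\<integral>y. F y \<partial>M)"
  have "AE x in M. \<forall>j. e ((T ^^ Suc j) x) = \<xi> * e ((T ^^ j) x)"
    unfolding AE_all_countable using AE_funpow[OF eT] by simp
  with e2 birkhoff_ergodic[OF erg F FC]
  have lim: "AE x in M. (\<lambda>n. FB_avg T f \<xi> n x) \<longlonglongrightarrow> c * e x"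
  proof eventually_elim
    case (elim x)
    have ee: "cnj (e x) * e x = 1"
      using complex_norm_square[of "e x"] elim(1) by (simp add: mult.commute)
    have \<xi>inv: "cnj \<xi> = inverse \<xi>"
      using complex_norm_square[of \<xi>] \<xi> by (metis inverse_unique of_real_1 one_power2)
    have ej: "e ((T ^^ j) x) = \<xi> ^ j * e x" for j
      using elim(3) by (induction j) (auto simp: mult.assoc)
    have "FB_avg T F 1 n x * e x = FB_avg T f \<xi> n x" for n
    proof -
      have "F ((T ^^ j) x) * e x = \<xi> powi (- int j) * f ((T ^^ j) x)" for j
      proof -
        have "F ((T ^^ j) x) * e x = f ((T ^^ j) x) * cnj \<xi> ^ j * (cnj (e x) * e x)"
          by (simp add: F_def ej mult.assoc)
        then show ?thesis by (simp add: ee \<xi>inv power_int_minus power_inverse)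
      qed
      then show ?thesis by (simp add: FB_avg_def sum_distrib_right del: power_int_minus)
    qed
    then show ?case using tendsto_mult_right[OF elim(2), of "e x"] by (simp add: c_def)
  qed
  \<comment> \<open>Comparing with the limit in \<open>L\<^sup>2\<close> identifies \<open>|c|\<close>.\<close>
  have "(\<lambda>n. \<integral>x. (cmod (FB_avg T f \<xi> n x))\<^sup>2 \<partial>M) \<longlonglongrightarrow> (\<integral>x. (cmod c)\<^sup>2 \<partial>M)"
  proof (rule integral_dominated_convergence[where w = "\<lambda>_. C\<^sup>2"])
    show "AE x in M. (\<lambda>n. (cmod (FB_avg T f \<xi> n x))\<^sup>2) \<longlonglongrightarrow> (cmod c)\<^sup>2"
      using lim e2
    proof eventually_elim
      case (elim x)
      have "(\<lambda>n. (cmod (FB_avg T f \<xi> n x))\<^sup>2) \<longlonglongrightarrow> (cmod (c * e x))\<^sup>2"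
        by (intro tendsto_intros elim)
      then show ?case by (simp add: norm_mult elim)
    qed
    show "AE x in M. norm ((cmod (FB_avg T f \<xi> n x))\<^sup>2) \<le> C\<^sup>2" for n
      using FB_avg_bound[of \<xi> f C T n, OF \<xi> C] by (auto intro!: power_mono)
  qed (auto simp: \<xi>)
  then have "(\<lambda>n. (L2_norm M (FB_avg T f \<xi> n))\<^sup>2) \<longlonglongrightarrow> (cmod c)\<^sup>2"
    by (simp add: L2_norm_sq)
  moreover have "(\<lambda>n. (L2_norm M (FB_avg T f \<xi> n))\<^sup>2) \<longlonglongrightarrow> (L2_norm M (eigen_part \<xi> f))\<^sup>2"
    by (intro tendsto_intros L2_norm_FB_avg_lim[OF f C \<xi>])
  ultimately have "(cmod c)\<^sup>2 = (L2_norm M (eigen_part \<xi> f))\<^sup>2" by (rule LIMSEQ_unique)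
  then have c_norm: "cmod c = L2_norm M (eigen_part \<xi> f)" by (simp add: L2_norm_nonneg)
  show ?thesis
    using lim e2
  proof eventually_elim
    case (elim x)
    have "(\<lambda>n. cmod (FB_avg T f \<xi> n x)) \<longlonglongrightarrow> cmod (c * e x)" by (intro tendsto_norm elim)
    then show ?case using elim by (auto simp: convergent_def norm_mult c_norm)
  qed
qed

end

section \<open>Uniform approximation by countably many continuous functions\<close>

text \<open>
  A uniformly continuous \<open>f\<close> is interpolated from approximate values at the points of a finite
  \<open>\<delta>\<close>-net, using the tent functions around these points as a partition of unity.
\<close>
lemma continuous_functions_countable_dense:
  assumes compact: "compact (UNIV :: 'a::metric_space set)"
  obtains G :: "('a::metric_space \<Rightarrow> complex) set" where "countable G" "\<And>g. g \<in> G \<Longrightarrow> continuous_on UNIV g"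
    "\<And>f e. continuous_on UNIV f \<Longrightarrow> e > 0 \<Longrightarrow> \<exists>g\<in>G. \<forall>x. cmod (f x - g x) \<le> e"
proof -
  obtain D :: "complex set" where D: "countable D" "\<And>X. open X \<Longrightarrow> X \<noteq> {} \<Longrightarrow> \<exists>d\<in>D. d \<in> X"
    using countable_dense_exists[where 'a = complex] by blast
  define \<delta> where "\<delta> n = 1 / real (Suc n)" for n
  have \<delta>0: "\<delta> n > 0" for n by (simp add: \<delta>_def)
  have "\<exists>P. finite P \<and> (\<forall>x::'a. \<exists>p\<in>P. dist p x < \<delta> n)" for n
  proof -
    obtain P where "finite P" "(UNIV :: 'a set) \<subseteq> (\<Union>p\<in>P. ball p (\<delta> n))"
      using compact \<delta>0[of n] unfolding compact_eq_totally_bounded by blast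
    then have "\<exists>p\<in>P. dist p x < \<delta> n" for x by (auto simp: subset_iff)
    with \<open>finite P\<close> show ?thesis by blast
  qed
  then have "\<exists>P. \<forall>n. finite (P n) \<and> (\<forall>x::'a. \<exists>p\<in>P n. dist p x < \<delta> n)" by (intro choice) blast
  then obtain P :: "nat \<Rightarrow> 'a set" where P: "\<And>n. finite (P n)" "\<And>n x. \<exists>p\<in>P n. dist p x < \<delta> n"
    by blast
  define \<psi> where "\<psi> n p x = max 0 (\<delta> n - dist p x)" for n p and x :: 'a
  have \<psi>0: "0 \<le> \<psi> n p x" for n p x by (simp add: \<psi>_def)
  have \<psi>pos: "0 < (\<Sum>p\<in>P n. \<psi> n p x)" for n x
  proof -
    obtain p where p: "p \<in> P n" "dist p x < \<delta> n" using P(2) by blast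
    then have "0 < \<psi> n p x" by (simp add: \<psi>_def)
    then show ?thesis using p(1) P(1) \<psi>0 by (intro sum_pos2) auto
  qed
  define g where "g n q x = (\<Sum>p\<in>P n. q p * of_real (\<psi> n p x)) / of_real (\<Sum>p\<in>P n. \<psi> n p x)"
    for n x and q :: "'a \<Rightarrow> complex"
  define G where "G = (\<Union>n. g n ` (PiE (P n) (\<lambda>_. D)))"
  show thesis
  proof
    show "countable G"
      unfolding G_def using D(1) P(1) by (intro countable_UN countable_image countable_PiE) auto
  next
    fix k assume "k \<in> G"
    then obtain n q where k: "k = g n q" by (auto simp: G_def)
    have "complex_of_real (\<Sum>p\<in>P n. \<psi> n p x) \<noteq> 0" for x
      using \<psi>pos[of n x] by (simp only: of_real_eq_0_iff)
    moreover have "continuous_on UNIV (\<psi> n p)" for p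
      unfolding \<psi>_def by (intro continuous_intros)
    ultimately show "continuous_on UNIV k"
      unfolding k g_def by (intro continuous_intros) blast+
  next
    fix f :: "'a \<Rightarrow> complex" and e :: real assume f: "continuous_on UNIV f" and e: "e > 0"
    have "uniformly_continuous_on UNIV f"
      by (rule compact_uniformly_continuous[OF f compact])
    then obtain \<eta> where \<eta>: "\<eta> > 0" "\<And>x y. dist x y < \<eta> \<Longrightarrow> dist (f x) (f y) < e / 2"
      using e unfolding uniformly_continuous_on_def by (metis UNIV_I half_gt_zero)
    obtain n where n: "\<delta> n < \<eta>" using nat_approx_posE[OF \<eta>(1)] by (auto simp: \<delta>_def)
    have "\<exists>d\<in>D. d \<in> ball (f p) (e / 2)" for p using D(2)[of "ball (f p) (e / 2)"] e by simp
    then obtain q where q: "\<And>p. q p \<in> D" "\<And>p. dist (f p) (q p) < e / 2" by (metis mem_ball)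
    define q' where "q' = restrict q (P n)"
    have "q' \<in> PiE (P n) (\<lambda>_. D)" using q(1) by (auto simp: q'_def)
    then have "g n q' \<in> G" unfolding G_def by blast
    moreover have "cmod (f x - g n q' x) \<le> e" for x
    proof -
      define s where "s = (\<Sum>p\<in>P n. \<psi> n p x)"
      have s: "s > 0" by (simp add: s_def \<psi>pos)
      have "f x - g n q' x = (\<Sum>p\<in>P n. (f x - q p) * of_real (\<psi> n p x)) / of_real s"
      proof -
        have "(\<Sum>p\<in>P n. f x * of_real (\<psi> n p x)) = f x * of_real s"
          by (simp add: s_def sum_distrib_left)
        then show ?thesis
          using s by (simp add: g_def q'_def s_def[symmetric] left_diff_distrib sum_subtractf diff_divide_distrib)
      qed
      then have "cmod (f x - g n q' x) = cmod (\<Sum>p\<in>P n. (f x - q p) * of_real (\<psi> n p x)) / s"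
        using s by (simp add: norm_divide)
      also have "cmod (\<Sum>p\<in>P n. (f x - q p) * of_real (\<psi> n p x)) \<le> (\<Sum>p\<in>P n. e * \<psi> n p x)"
      proof (rule order_trans[OF norm_sum sum_mono])
        fix p
        show "cmod ((f x - q p) * of_real (\<psi> n p x)) \<le> e * \<psi> n p x"
        proof (cases "dist p x < \<delta> n")
          case True
          then have "dist (f p) (f x) < e / 2" using n by (intro \<eta>(2)) simp
          then have "cmod (f x - q p) \<le> e"
            using q(2)[of p] dist_triangle2[of "f x" "q p" "f p"]
            by (simp add: dist_norm norm_minus_commute)
          then show ?thesis using \<psi>0[of n p x] by (simp add: norm_mult mult_right_mono)
        qed (simp add: \<psi>_def)
      qed
      also have "\<dots> = e * s" by (simp add: s_def sum_distrib_left)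
      finally show ?thesis using s by (simp add: divide_right_mono)
    qed
    ultimately show "\<exists>g\<in>G. \<forall>x. cmod (f x - g x) \<le> e" by blast
  qed
qed

lemma tendsto_if_approximable:
  fixes u :: "nat \<Rightarrow> 'b::real_normed_vector"
  assumes "\<And>e. e > 0 \<Longrightarrow> \<exists>v l'. v \<longlonglongrightarrow> l' \<and> (\<forall>n. norm (u n - v n) \<le> e) \<and> norm (l - l') \<le> e"
  shows "u \<longlonglongrightarrow> l"
proof (rule LIMSEQ_I)
  fix r :: real assume "r > 0"
  then obtain v l' where v: "v \<longlonglongrightarrow> l'" "\<And>n. norm (u n - v n) \<le> r / 4" "norm (l - l') \<le> r / 4"
    using assms[of "r / 4"] by auto
  obtain N where N: "\<And>n. n \<ge> N \<Longrightarrow> norm (v n - l') < r / 4"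
    using LIMSEQ_D[OF v(1), of "r / 4"] \<open>r > 0\<close> by auto
  have "norm (u n - l) < r" if "n \<ge> N" for n
  proof -
    have "norm (u n - l) \<le> norm (u n - v n) + norm (v n - l') + norm (l - l')"
      using norm_triangle_ineq4[of "(u n - v n) + (v n - l')" "l - l'"]
        norm_triangle_ineq[of "u n - v n" "v n - l'"] by simp
    then show ?thesis using v(2)[of n] v(3) N[OF that] \<open>r > 0\<close> by linarith
  qed
  then show "\<exists>no. \<forall>n\<ge>no. norm (u n - l) < r" by blast
qed

lemma convergent_if_approximable:
  fixes u :: "nat \<Rightarrow> 'b::banach"
  assumes "\<And>e. e > 0 \<Longrightarrow> \<exists>v. convergent v \<and> (\<forall>n. norm (u n - v n) \<le> e)"
  shows "convergent u"
  unfolding Cauchy_convergent_iff[symmetric]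
proof (rule CauchyI)
  fix r :: real assume "r > 0"
  then obtain v where v: "convergent v" "\<And>n. norm (u n - v n) \<le> r / 4"
    using assms[of "r / 4"] by auto
  obtain N where N: "\<And>m n. m \<ge> N \<Longrightarrow> n \<ge> N \<Longrightarrow> norm (v m - v n) < r / 4"
    using CauchyD[OF convergent_Cauchy[OF v(1)], of "r / 4"] \<open>r > 0\<close> by (metis divide_pos_pos zero_less_numeral)
  have "norm (u m - u n) < r" if "m \<ge> N" "n \<ge> N" for m n
  proof -
    have "norm (u m - u n) \<le> norm (u m - v m) + norm (v m - v n) + norm (u n - v n)"
      using norm_triangle_ineq4[of "(u m - v m) + (v m - v n)" "u n - v n"]
        norm_triangle_ineq[of "u m - v m" "v m - v n"] by simp
    then show ?thesis using v(2)[of n] v(2)[of m] N[OF that] \<open>r > 0\<close> by linarith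
  qed
  then show "\<exists>M. \<forall>m\<ge>M. \<forall>n\<ge>M. norm (u m - u n) < r" by blast
qed

section \<open>Almost every point is Wiener--Wintner generic\<close>

context compact_system
begin

lemma FB_avg_norm_diff_le:
  assumes "cmod \<xi> = 1" "\<And>y. cmod (f y - g y) \<le> e"
  shows "cmod (FB_avg T f \<xi> n x - FB_avg T g \<xi> n x) \<le> e"
  using FB_avg_bound[OF assms(1), of "\<lambda>y. f y - g y" e] assms(2) by (simp add: FB_avg_diff)

lemma L2_norm_eigen_part_diff_le:
  assumes f: "continuous_on UNIV f" and g: "continuous_on UNIV g" and \<xi>: "cmod \<xi> = 1"
    and e: "\<And>y. cmod (f y - g y) \<le> e"
  shows "\<bar>L2_norm M (eigen_part \<xi> f) - L2_norm M (eigen_part \<xi> g)\<bar> \<le> e"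
proof -
  obtain C where C: "\<And>x. cmod (f x) \<le> C" using continuous_bounded[OF f] by blast
  obtain D where D: "\<And>x. cmod (g x) \<le> D" using continuous_bounded[OF g] by blast
  note fm = continuous_measurable[OF f] and gm = continuous_measurable[OF g]
  have "\<bar>L2_norm M (FB_avg T f \<xi> n) - L2_norm M (FB_avg T g \<xi> n)\<bar> \<le> e" for n
  proof -
    have "\<bar>L2_norm M (FB_avg T f \<xi> n) - L2_norm M (FB_avg T g \<xi> n)\<bar>
        \<le> L2_norm M (\<lambda>x. FB_avg T f \<xi> n x - FB_avg T g \<xi> n x)"
      by (intro L2_norm_reverse_triangle L2_FB_avg L2_bounded[OF fm C] L2_bounded[OF gm D])
    also have "\<dots> \<le> e"
    proof (rule L2_norm_le_sup)
      note [measurable] = fm gm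
      show "(\<lambda>x. FB_avg T f \<xi> n x - FB_avg T g \<xi> n x) \<in> borel_measurable M" by measurable
    qed (rule FB_avg_norm_diff_le[OF \<xi> e])
    finally show ?thesis .
  qed
  moreover have "(\<lambda>n. \<bar>L2_norm M (FB_avg T f \<xi> n) - L2_norm M (FB_avg T g \<xi> n)\<bar>)
      \<longlonglongrightarrow> \<bar>L2_norm M (eigen_part \<xi> f) - L2_norm M (eigen_part \<xi> g)\<bar>"
    by (intro tendsto_intros L2_norm_FB_avg_lim[OF fm C \<xi>] L2_norm_FB_avg_lim[OF gm D \<xi>])
  ultimately show ?thesis by (intro LIMSEQ_le_const2) auto
qed

text \<open>
  The Wiener--Wintner identity follows termwise: a point where \<open>|A[f,\<xi>](x)|\<close> is the norm of the
  \<open>\<xi>\<close>-part of \<open>f\<close> picks up exactly the squared norm of the projection, and the frequencies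
  outside \<open>Freq\<close> contribute \<open>0\<close>.
\<close>
lemma WW_genericI:
  assumes gen: "generic_point T M x"
    and conv: "\<And>f \<xi>. continuous_on UNIV f \<Longrightarrow> cmod \<xi> = 1 \<Longrightarrow> convergent (\<lambda>n. FB_avg T f \<xi> n x)"
    and norm: "\<And>f \<xi>. continuous_on UNIV f \<Longrightarrow> cmod \<xi> = 1 \<Longrightarrow>
      (\<lambda>n. cmod (FB_avg T f \<xi> n x)) \<longlonglongrightarrow> L2_norm M (eigen_part \<xi> f)"
  shows "WW_generic T M x"
  unfolding WW_generic_def
proof (intro conjI allI impI)
  show "FB_generic T M x" using gen conv by (simp add: FB_generic_def)
  fix f :: "'a \<Rightarrow> complex" assume f: "continuous_on UNIV f"
  obtain C where C: "\<And>x. cmod (f x) \<le> C" using continuous_bounded[OF f] by blast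
  have lim: "cmod (FB_lim T f \<xi> x) = L2_norm M (eigen_part \<xi> f)" if "cmod \<xi> = 1" for \<xi>
  proof -
    have "(\<lambda>n. FB_avg T f \<xi> n x) \<longlonglongrightarrow> FB_lim T f \<xi> x"
      using conv[OF f that] by (simp add: FB_lim_def convergent_LIMSEQ_iff)
    then have "(\<lambda>n. cmod (FB_avg T f \<xi> n x)) \<longlonglongrightarrow> cmod (FB_lim T f \<xi> x)" by (rule tendsto_norm)
    then show ?thesis using norm[OF f that] by (rule LIMSEQ_unique)
  qed
  have zero: "L2_norm M (eigen_part \<xi> f) = 0" if "cmod \<xi> = 1" "\<xi> \<notin> Freq T x" for \<xi>
  proof -
    have "(\<lambda>n. ereal (cmod (FB_avg T f \<xi> n x))) \<longlonglongrightarrow> ereal (L2_norm M (eigen_part \<xi> f))"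
      using norm[OF f that(1)] by simp
    then have "limsup (\<lambda>n. ereal (cmod (FB_avg T f \<xi> n x))) = ereal (L2_norm M (eigen_part \<xi> f))"
      by (intro lim_imp_Limsup) simp_all
    moreover have "\<not> limsup (\<lambda>n. ereal (cmod (FB_avg T f \<xi> n x))) > 0"
      using that f by (auto simp: Freq_def)
    ultimately show ?thesis using L2_norm_nonneg[of M "eigen_part \<xi> f"] by simp
  qed
  show "((\<lambda>\<xi>. (cmod (FB_lim T f \<xi> x))\<^sup>2) has_sum
      (L2_norm M (orth_proj M (kronecker_space T M) f))\<^sup>2) (Freq T x)"
    using kronecker_norm_has_sum[OF continuous_measurable[OF f] C]
    by (rule has_sum_cong_neutral[THEN iffD1, rotated -1]) (auto simp: lim zero Freq_def)
qed

text \<open>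
  One null set serves all \<open>f\<close> and \<open>\<xi>\<close>: outside it the mean of every function in a countable dense
  set is correct, so \<open>x\<close> is generic and van der Corput's bound handles each \<open>\<xi>\<close> with vanishing
  eigenpart; for each function in the dense set only countably many \<open>\<xi>\<close> remain.
\<close>
lemma ergodic_imp_AE_WW_generic:
  assumes erg: "ergodic T M"
  shows "AE x in M. WW_generic T M x"
proof -
  obtain G :: "('a \<Rightarrow> complex) set" where G: "countable G" "\<And>g. g \<in> G \<Longrightarrow> continuous_on UNIV g"
    "\<And>f e. continuous_on UNIV f \<Longrightarrow> e > 0 \<Longrightarrow> \<exists>g\<in>G. \<forall>x. cmod (f x - g x) \<le> e"
    using continuous_functions_countable_dense[OF compact_UNIV] by blast
  define S where "S g = {\<xi> \<in> sphere 0 1. (L2_norm M (eigen_part \<xi> g))\<^sup>2 \<noteq> 0}" for g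
  have S_countable: "countable (S g)" if g: "g \<in> G" for g
  proof -
    obtain C where "\<And>x. cmod (g x) \<le> C" using continuous_bounded[OF G(2)[OF g]] by blast
    then show ?thesis
      unfolding S_def using continuous_measurable[OF G(2)[OF g]]
      by (intro summable_countable_real eigen_part_summable) auto
  qed
  have mean: "AE x in M. \<forall>g\<in>G. (\<lambda>n. FB_avg T g 1 n x) \<longlonglongrightarrow> (\<integral>y. g y \<partial>M)"
  proof (subst AE_ball_countable[OF G(1)], intro ballI)
    fix g assume g: "g \<in> G"
    obtain C where "\<And>x. cmod (g x) \<le> C" using continuous_bounded[OF G(2)[OF g]] by blast
    then show "AE x in M. (\<lambda>n. FB_avg T g 1 n x) \<longlonglongrightarrow> (\<integral>y. g y \<partial>M)"
      using continuous_measurable[OF G(2)[OF g]] by (intro birkhoff_ergodic[OF erg])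
  qed
  have twisted: "AE x in M. \<forall>g\<in>G. \<forall>\<xi>\<in>S g. convergent (\<lambda>n. FB_avg T g \<xi> n x) \<and>
      (\<lambda>n. cmod (FB_avg T g \<xi> n x)) \<longlonglongrightarrow> L2_norm M (eigen_part \<xi> g)"
  proof (subst AE_ball_countable[OF G(1)], intro ballI, subst AE_ball_countable[OF S_countable], assumption, intro ballI)
    fix g \<xi> assume g: "g \<in> G" and \<xi>: "\<xi> \<in> S g"
    obtain C where "\<And>x. cmod (g x) \<le> C" using continuous_bounded[OF G(2)[OF g]] by blast
    then show "AE x in M. convergent (\<lambda>n. FB_avg T g \<xi> n x) \<and>
        (\<lambda>n. cmod (FB_avg T g \<xi> n x)) \<longlonglongrightarrow> L2_norm M (eigen_part \<xi> g)"
      using continuous_measurable[OF G(2)[OF g]] \<xi>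
      by (intro ergodic_FB_avg_converges[OF erg]) (auto simp: S_def)
  qed
  from mean twisted show ?thesis
  proof eventually_elim
    case (elim x)
    have mean_all: "(\<lambda>n. FB_avg T f 1 n x) \<longlonglongrightarrow> (\<integral>y. f y \<partial>M)" if f: "continuous_on UNIV f" for f
    proof (rule tendsto_if_approximable)
      fix e :: real assume "e > 0"
      then obtain g where g: "g \<in> G" "\<And>y. cmod (f y - g y) \<le> e" using G(3)[OF f] by blast
      obtain C where C: "\<And>x. cmod (f x) \<le> C" using continuous_bounded[OF f] by blast
      obtain D where D: "\<And>x. cmod (g x) \<le> D" using continuous_bounded[OF G(2)[OF g(1)]] by blast
      have "integrable M f" "integrable M g"
        using C D continuous_measurable[OF f] continuous_measurable[OF G(2)[OF g(1)]]
        by (auto intro: integrable_const_bound)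
      then have "cmod ((\<integral>y. f y \<partial>M) - (\<integral>y. g y \<partial>M)) = cmod (\<integral>y. f y - g y \<partial>M)" by simp
      also have "\<dots> \<le> (\<integral>y. cmod (f y - g y) \<partial>M)" by (rule integral_norm_bound)
      also have "\<dots> \<le> (\<integral>y. e \<partial>M)"
        using \<open>integrable M f\<close> \<open>integrable M g\<close> g(2) by (intro integral_mono) auto
      finally have "cmod ((\<integral>y. f y \<partial>M) - (\<integral>y. g y \<partial>M)) \<le> e" by simp
      moreover have "\<forall>n. cmod (FB_avg T f 1 n x - FB_avg T g 1 n x) \<le> e"
        by (intro allI FB_avg_norm_diff_le g(2)) simp
      ultimately show "\<exists>v l'. v \<longlonglongrightarrow> l' \<and> (\<forall>n. cmod (FB_avg T f 1 n x - v n) \<le> e)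
          \<and> cmod ((\<integral>y. f y \<partial>M) - l') \<le> e"
        using elim(1) g(1) by blast
    qed
    have gen: "generic_point T M x"
      using mean_all unfolding generic_point_def FB_avg_def by simp
    have on_G: "convergent (\<lambda>n. FB_avg T g \<xi> n x) \<and>
        (\<lambda>n. cmod (FB_avg T g \<xi> n x)) \<longlonglongrightarrow> L2_norm M (eigen_part \<xi> g)"
      if g: "g \<in> G" and \<xi>: "cmod \<xi> = 1" for g \<xi>
    proof (cases "\<xi> \<in> S g")
      case True
      then show ?thesis using elim(2) g by blast
    next
      case False
      then have zero: "L2_norm M (eigen_part \<xi> g) = 0" using \<xi> by (simp add: S_def)
      have "(\<lambda>n. FB_avg T g \<xi> n x) \<longlonglongrightarrow> 0"
      proof (rule tendstoI)
        fix e :: real assume "e > 0"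
        from generic_FB_avg_bound[OF gen G(2)[OF g] \<xi> this]
        show "\<forall>\<^sub>F n in sequentially. dist (FB_avg T g \<xi> n x) 0 < e" by (simp add: zero)
      qed
      then show ?thesis using tendsto_norm_zero by (auto simp: zero convergent_def)
    qed
    show ?case
    proof (rule WW_genericI[OF gen])
      fix f :: "'a \<Rightarrow> complex" and \<xi> assume f: "continuous_on UNIV f" and \<xi>: "cmod \<xi> = 1"
      show "convergent (\<lambda>n. FB_avg T f \<xi> n x)"
      proof (rule convergent_if_approximable)
        fix e :: real assume "e > 0"
        then obtain g where g: "g \<in> G" "\<And>y. cmod (f y - g y) \<le> e" using G(3)[OF f] by blast
        have "\<forall>n. cmod (FB_avg T f \<xi> n x - FB_avg T g \<xi> n x) \<le> e"
          by (intro allI FB_avg_norm_diff_le \<xi> g(2))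
        then show "\<exists>v. convergent v \<and> (\<forall>n. cmod (FB_avg T f \<xi> n x - v n) \<le> e)"
          using on_G[OF g(1) \<xi>] by blast
      qed
      show "(\<lambda>n. cmod (FB_avg T f \<xi> n x)) \<longlonglongrightarrow> L2_norm M (eigen_part \<xi> f)"
      proof (rule tendsto_if_approximable)
        fix e :: real assume "e > 0"
        then obtain g where g: "g \<in> G" "\<And>y. cmod (f y - g y) \<le> e" using G(3)[OF f] by blast
        have "norm (cmod (FB_avg T f \<xi> n x) - cmod (FB_avg T g \<xi> n x)) \<le> e" for n
        proof -
          have "cmod (FB_avg T f \<xi> n x - FB_avg T g \<xi> n x) \<le> e"
            by (intro FB_avg_norm_diff_le \<xi> g(2))
          then show ?thesis
            using norm_triangle_ineq3[of "FB_avg T f \<xi> n x" "FB_avg T g \<xi> n x"] by simp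
        qed
        moreover have "norm (L2_norm M (eigen_part \<xi> f) - L2_norm M (eigen_part \<xi> g)) \<le> e"
          using L2_norm_eigen_part_diff_le[OF f G(2)[OF g(1)] \<xi> g(2)] by simp
        ultimately show "\<exists>v l'. v \<longlonglongrightarrow> l' \<and> (\<forall>n. norm (cmod (FB_avg T f \<xi> n x) - v n) \<le> e)
            \<and> norm (L2_norm M (eigen_part \<xi> f) - l') \<le> e"
          using on_G[OF g(1) \<xi>] by blast
      qed
    qed
  qed
qed

end

section \<open>Ergodicity and Wiener--Wintner generic points\<close>

lemma compact_system_invariant_measure:
  fixes T :: "'a::metric_space \<Rightarrow> 'a"
  assumes "compact (UNIV :: 'a set)" "continuous_on UNIV T" "M \<in> invariant_measures T"
  shows "compact_system M T"
proof -
  from assms(3) have sets: "sets M = sets borel" and prob: "prob_space M" and distr: "distr M borel T = M"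
    by (auto simp: invariant_measures_def)
  interpret prob_space M by (rule prob)
  have T: "T \<in> measurable M M"
    using borel_measurable_continuous_onI[OF assms(2)] measurable_cong_sets[OF sets sets] by blast
  have "distr M M T = distr M borel T" by (rule distr_cong) (auto simp: sets)
  then have "distr M M T = M" using distr by simp
  with T show ?thesis by unfold_locales (use assms sets in auto)
qed

theorem theorem4p5:
  fixes T :: "'a::metric_space \<Rightarrow> 'a" and \<mu> :: "'a measure"
  assumes "compact (UNIV :: 'a set)"
    and "\<exists>S. homeomorphism UNIV UNIV T S"
    and "\<mu> \<in> invariant_measures T"
  shows "(ergodic T \<mu> \<longleftrightarrow>
            (\<exists>Y\<in>sets borel. measure \<mu> Y = 1 \<and> (\<forall>x\<in>Y. WW_generic T \<mu> x)))
       \<and> ((\<exists>Y\<in>sets borel. measure \<mu> Y = 1 \<and> (\<forall>x\<in>Y. WW_generic T \<mu> x)) \<longleftrightarrow>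
            (\<exists>x. WW_generic T \<mu> x))"
proof -
  have "continuous_on UNIV T" using assms(2) by (auto simp: homeomorphism_def)
  then interpret compact_system \<mu> T
    using assms(1,3) by (intro compact_system_invariant_measure)
  have "\<exists>Y\<in>sets borel. measure \<mu> Y = 1 \<and> (\<forall>x\<in>Y. WW_generic T \<mu> x)" if erg: "ergodic T \<mu>"
  proof -
    obtain N where N: "{x \<in> space \<mu>. \<not> WW_generic T \<mu> x} \<subseteq> N" "N \<in> null_sets \<mu>"
      using ergodic_imp_AE_WW_generic[OF erg] by (auto elim: AE_E simp: null_sets_def)
    then have "measure \<mu> (UNIV - N) = 1" "UNIV - N \<in> sets borel"
      using prob_compl[of N] by (auto simp: null_sets_def measure_def sets_M)
    with N(1) show ?thesis by (intro bexI[of _ "UNIV - N"]) auto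
  qed
  moreover have "\<exists>x. WW_generic T \<mu> x"
    if "\<exists>Y\<in>sets borel. measure \<mu> Y = 1 \<and> (\<forall>x\<in>Y. WW_generic T \<mu> x)"
  proof -
    from that obtain Y where Y: "measure \<mu> Y = 1" "\<forall>x\<in>Y. WW_generic T \<mu> x" by blast
    from Y(1) have "Y \<noteq> {}" by auto
    with Y(2) show ?thesis by blast
  qed
  moreover have "ergodic T \<mu>" if "\<exists>x. WW_generic T \<mu> x"
    using that WW_generic_imp_ergodic by blast
  ultimately show ?thesis by blast
qed

end
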